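(* Let $\mathscr{A}\subset\mathscr{B}$ be an inclusion of $C^*$-algebras. Let $R,S>0$ and let $I_1,J_1,I_2,J_2$ be index sets. Suppose $a=(a_i)_{i\in I_1}$ and $b=(b_j)_{j\in J_1}$ are both $R$-bounded such that $a$ generates $\mathscr{A}$ and $a$ and $b$ jointly generate $\mathscr{B}$. Similarly, suppose $c=(c_i)_{i\in I_2}$ and $d=(d_j)_{j\in J_2}$ are $S$-bounded such that $c$ generates $\mathscr{A}$ and $c$ and $d$ jointly generate $\mathscr{B}$. Then $$h^{\mathrm{top}}(a:b)=h^{\mathrm{top}}(c:d).$$
   Context: $C^*$-algebras are unital, inclusions are unital, and "generates" means generates as a unital $C^*$-algebra (norm closure). A tuple $(x_i)_i$ is $C$-bounded if $\|x_i\|\le C$ for all $i$. For an index set $I$, $\mathbb{C}^*\langle T_i\mid i\in I\rangle$ is the unital $*$-algebra of noncommutative complex polynomials in free variables $T_i$ and their formal adjoints. $\|\cdot\|$ on matrices is the operator norm. For a $C$-bounded tuple $x=(x_i)_{i\in I}$ in a $C^*$-algebra, a finite set $Q\subset\mathbb{C}^*\langle T_i\mid i\in I\rangle$, $\delta>0$ and $N\in\mathbb{N}$, let $$\Gamma_C^{(N,\mathrm{top})}(x;Q,\delta)=\{A\in M_N(\mathbb{C})^I:\ \|A_i\|\le C\ \forall i\in I,\ \|P(A)\|\le\|P(x)\|+\delta\ \forall P\in Q\}.$$ For $\Omega\subset M_N(\mathbb{C})^I$, $F\subset I$ finite, $\epsilon>0$, $K^{\mathrm{orb}}_{F,\epsilon}(\Omega,\|\cdot\|)$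 is the minimal cardinality of $\Omega_0\subset\Omega$ such that for each $D\in\Omega$ there are $B\in\Omega_0$ and a unitary $U\in U(N)$ with $\|D_i-UB_iU^*\|<\epsilon$ for all $i\in F$. If $a=(a_i)_{i\in I}$ generates $\mathscr{A}$, $a$ and $b=(b_j)_{j\in J}$ jointly generate $\mathscr{B}$, and both are $C$-bounded, then $$h^{\mathrm{top}}(a:b)=\sup_{\epsilon,F}\inf_{\delta,Q}\limsup_{N\to\infty}\frac1{N^2}\log K^{\mathrm{orb}}_{F,\epsilon}\big(\Gamma_C^{(N,\mathrm{top})}((a,b);Q,\delta),\|\cdot\|\big),$$ where $\epsilon>0$, $F$ ranges over finite subsets of $I$ only, $\delta>0$, $Q$ ranges over finite subsets of $\mathbb{C}^*\langle T_i\mid i\in I\sqcup J\rangle$, and $\log0=-\infty$. For $(a,b)$ the cutoff is $C=R$, and for $(c,d)$ it is $C=S$. *)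

theory Defs
  imports
    "HOL-Library.Extended_Real"
    "HOL-Library.FuncSet"
    "HOL-Library.Poly_Mapping"
    "HOL-Analysis.Elementary_Metric_Spaces"
    "HOL-Analysis.L2_Norm"
    "Jordan_Normal_Form.Schur_Decomposition"
begin

text \<open>The class extends \<open>real_normed_algebra\<close> and \<open>monoid_mult\<close> rather than
  \<open>real_normed_algebra_1\<close>, so that the zero algebra (where \<open>1 = 0\<close>) is not excluded.\<close>

class cstar_algebra = real_normed_algebra + monoid_mult + banach +
  fixes scaleC :: "complex \<Rightarrow> 'a \<Rightarrow> 'a" (infixr \<open>*\<^sub>C\<close> 75)
    and star :: "'a \<Rightarrow> 'a"
  assumes scaleC_add_right: "c *\<^sub>C (x + y) = c *\<^sub>C x + c *\<^sub>C y"
    and scaleC_add_left: "(c + d) *\<^sub>C x = c *\<^sub>C x + d *\<^sub>C x"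
    and scaleC_scaleC: "c *\<^sub>C d *\<^sub>C x = (c * d) *\<^sub>C x"
    and scaleR_scaleC: "r *\<^sub>R x = complex_of_real r *\<^sub>C x"
    and mult_scaleC_left: "(c *\<^sub>C x) * y = c *\<^sub>C (x * y)"
    and mult_scaleC_right: "x * (c *\<^sub>C y) = c *\<^sub>C (x * y)"
    and norm_scaleC: "norm (c *\<^sub>C x) = cmod c * norm x"
    and star_add: "star (x + y) = star x + star y"
    and star_scaleC: "star (c *\<^sub>C x) = cnj c *\<^sub>C star x"
    and star_mult: "star (x * y) = star y * star x"
    and star_star: "star (star x) = x"
    and norm_star_mult: "norm (star x * x) = (norm x)\<^sup>2"

instantiation complex :: cstar_algebra
begin

definition scaleC_complex :: "complex \<Rightarrow> complex \<Rightarrow> complex" where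
  "scaleC_complex = (*)"

definition star_complex :: "complex \<Rightarrow> complex" where
  "star_complex = cnj"

instance
  by standard
    (auto simp: scaleC_complex_def star_complex_def algebra_simps norm_mult power2_eq_square
      scaleR_conv_of_real)

end

definition unital_star_subalgebra :: "'a::cstar_algebra set \<Rightarrow> bool" where
  "unital_star_subalgebra S \<longleftrightarrow>
     1 \<in> S \<and>
     (\<forall>x\<in>S. \<forall>y\<in>S. x + y \<in> S \<and> x * y \<in> S) \<and>
     (\<forall>c. \<forall>x\<in>S. c *\<^sub>C x \<in> S) \<and>
     (\<forall>x\<in>S. star x \<in> S)"

definition unital_cstar_subalgebra :: "'a::cstar_algebra set \<Rightarrow> bool" where
  "unital_cstar_subalgebra S \<longleftrightarrow> unital_star_subalgebra S \<and> closed S"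

definition cstar_generated :: "'a::cstar_algebra set \<Rightarrow> 'a set" where
  "cstar_generated X = closure (unital_star_subalgebra hull X)"

definition tuple_bounded :: "real \<Rightarrow> 'i set \<Rightarrow> ('i \<Rightarrow> 'a::cstar_algebra) \<Rightarrow> bool" where
  "tuple_bounded C I x \<longleftrightarrow> (\<forall>i\<in>I. norm (x i) \<le> C)"

text \<open>The words in the letters \<open>T\<^sub>i\<close>, \<open>T\<^sub>i\<^sup>*\<close> form a linear basis of the free unital
  *-algebra, so a *-polynomial is a finitely supported family of complex coefficients
  indexed by words; the empty word is the unit.\<close>

datatype 'i letter = Var (letter_index: 'i) | Adj (letter_index: 'i)

type_synonym 'i star_poly = "'i letter list \<Rightarrow>\<^sub>0 complex"

definition star_polys :: "'i set \<Rightarrow> 'i star_poly set" where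
  "star_polys I = {P. \<forall>w\<in>Poly_Mapping.keys P. letter_index ` set w \<subseteq> I}"

fun letter_eval :: "('i \<Rightarrow> 'a::cstar_algebra) \<Rightarrow> 'i letter \<Rightarrow> 'a" where
  "letter_eval x (Var i) = x i"
| "letter_eval x (Adj i) = star (x i)"

definition poly_eval :: "('i \<Rightarrow> 'a::cstar_algebra) \<Rightarrow> 'i star_poly \<Rightarrow> 'a" where
  "poly_eval x P =
     (\<Sum>w\<in>Poly_Mapping.keys P. Poly_Mapping.lookup P w *\<^sub>C prod_list (map (letter_eval x) w))"

definition l2_norm_vec :: "complex vec \<Rightarrow> real" where
  "l2_norm_vec v = L2_set (\<lambda>i. cmod (v $ i)) {..<dim_vec v}"

definition op_norm :: "complex mat \<Rightarrow> real" where
  "op_norm A = Sup {l2_norm_vec (A *\<^sub>v v) | v. v \<in> carrier_vec (dim_col A) \<and> l2_norm_vec v \<le> 1}"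

definition unitary_mats :: "nat \<Rightarrow> complex mat set" where
  "unitary_mats N =
     {U \<in> carrier_mat N N. U * mat_adjoint U = 1\<^sub>m N \<and> mat_adjoint U * U = 1\<^sub>m N}"

fun letter_eval_mat :: "('i \<Rightarrow> complex mat) \<Rightarrow> 'i letter \<Rightarrow> complex mat" where
  "letter_eval_mat A (Var i) = A i"
| "letter_eval_mat A (Adj i) = mat_adjoint (A i)"

definition word_eval_mat :: "nat \<Rightarrow> ('i \<Rightarrow> complex mat) \<Rightarrow> 'i letter list \<Rightarrow> complex mat" where
  "word_eval_mat N A w = foldr (*) (map (letter_eval_mat A) w) (1\<^sub>m N)"

text \<open>The sum is taken entrywise because the type of matrices of all sizes has no additive
  monoid structure.\<close>

definition poly_eval_mat :: "nat \<Rightarrow> ('i \<Rightarrow> complex mat) \<Rightarrow> 'i star_poly \<Rightarrow> complex mat" where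
  "poly_eval_mat N A P =
     mat N N (\<lambda>(r, s).
       \<Sum>w\<in>Poly_Mapping.keys P. Poly_Mapping.lookup P w * word_eval_mat N A w $$ (r, s))"

definition microstates ::
  "real \<Rightarrow> nat \<Rightarrow> 'i set \<Rightarrow> ('i \<Rightarrow> 'a::cstar_algebra) \<Rightarrow> 'i star_poly set \<Rightarrow> real
    \<Rightarrow> ('i \<Rightarrow> complex mat) set" where
  "microstates C N I x Q \<delta> =
     {A \<in> I \<rightarrow>\<^sub>E carrier_mat N N.
        (\<forall>i\<in>I. op_norm (A i) \<le> C) \<and>
        (\<forall>P\<in>Q. op_norm (poly_eval_mat N A P) \<le> norm (poly_eval x P) + \<delta>)}"

definition orb_cover ::
  "nat \<Rightarrow> 'i set \<Rightarrow> real \<Rightarrow> ('i \<Rightarrow> complex mat) set \<Rightarrow> ('i \<Rightarrow> complex mat) set \<Rightarrow> bool" where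
  "orb_cover N F \<epsilon> \<Omega> \<Omega>\<^sub>0 \<longleftrightarrow>
     \<Omega>\<^sub>0 \<subseteq> \<Omega> \<and>
     (\<forall>D\<in>\<Omega>. \<exists>B\<in>\<Omega>\<^sub>0. \<exists>U\<in>unitary_mats N.
        \<forall>i\<in>F. op_norm (D i - U * B i * mat_adjoint U) < \<epsilon>)"

text \<open>The value is \<open>\<infinity>\<close> if there is no finite cover.\<close>

definition orb_covering_number ::
  "nat \<Rightarrow> 'i set \<Rightarrow> real \<Rightarrow> ('i \<Rightarrow> complex mat) set \<Rightarrow> enat" where
  "orb_covering_number N F \<epsilon> \<Omega> = (INF \<Omega>\<^sub>0\<in>{\<Omega>\<^sub>0. finite \<Omega>\<^sub>0 \<and> orb_cover N F \<epsilon> \<Omega> \<Omega>\<^sub>0}. enat (card \<Omega>\<^sub>0))"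

fun log_enat :: "enat \<Rightarrow> ereal" where
  "log_enat (enat n) = (if n = 0 then -\<infinity> else ereal (ln (real n)))"
| "log_enat \<infinity> = \<infinity>"

text \<open>The tuple \<open>(a, b)\<close>, indexed by the disjoint union of \<open>I\<close> and \<open>J\<close>, is
  \<open>case_sum a b\<close> on \<open>I <+> J\<close>. The finite set \<open>F\<close> only ranges over indices of \<open>a\<close>.\<close>

definition h_top ::
  "real \<Rightarrow> 'i set \<Rightarrow> ('i \<Rightarrow> 'a::cstar_algebra) \<Rightarrow> 'j set \<Rightarrow> ('j \<Rightarrow> 'a) \<Rightarrow> ereal" where
  "h_top C I a J b =
     (SUP (\<epsilon>, F)\<in>{0<..} \<times> {F. finite F \<and> F \<subseteq> I}.
      INF (\<delta>, Q)\<in>{0<..} \<times> {Q. finite Q \<and> Q \<subseteq> star_polys (I <+> J)}.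
        limsup (\<lambda>N. ereal (1 / (real N)\<^sup>2) *
          log_enat (orb_covering_number N (Inl ` F) \<epsilon>
            (microstates C N (I <+> J) (case_sum a b) Q \<delta>))))"

end

theory Submission
  imports Defs
begin

text \<open>The entropy is a limit of covering numbers of matrix microstate spaces, so it suffices to compare
these spaces for two systems of generators \<open>x = (a, b)\<close> and \<open>y = (c, d)\<close> of the same pair of algebras.
Since \<open>y\<close> generates, every \<open>x\<^sub>j\<close> is close to a *-polynomial \<open>f\<^sub>j(y)\<close>. Applying the \<open>f\<^sub>j\<close> to
a microstate \<open>D\<close> of \<open>y\<close> gives a microstate \<open>f(D)\<close> of \<open>x\<close>: for a *-polynomial \<open>P\<close>, the
composite \<open>P \<circ> f\<close> is again a *-polynomial, so a sufficiently demanding microstate \<open>D\<close> satisfies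
\<open>\<parallel>P(f(D))\<parallel> \<le> \<parallel>P(f(y))\<parallel> + \<delta>'\<close>, and \<open>P(f(y))\<close> is close to \<open>P(x)\<close>. Only finitely many variables
occur in the polynomials that are tested, so the other coordinates of \<open>f(D)\<close> may be set to \<open>0\<close>.
The cutoff of \<open>x\<close> is respected after shrinking \<open>f\<^sub>j\<close> slightly (\<open>cstar_generated_approx_bounded\<close>).

To bring covers back, every \<open>y\<^sub>i\<close> with \<open>i\<close> in the finite set \<open>F\<close> is approximated by a
*-polynomial \<open>g\<^sub>i(x)\<close>. Here \<open>c\<close> lies in the algebra generated by \<open>a\<close> alone, so \<open>g\<^sub>i\<close>
involves only variables from \<open>a\<close>; this is what keeps the new finite set \<open>F'\<close> inside the index set
of \<open>a\<close>, where the definition of the entropy wants it. As \<open>g\<^sub>i \<circ> f - T\<^sub>i\<close> is small at \<open>y\<close>, it is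
small at every sufficiently good microstate \<open>D\<close>, so \<open>D\<^sub>i\<close> is close to \<open>g\<^sub>i(f(D))\<close>. If now \<open>f(D)\<close>
and \<open>f(E)\<close> are both close on \<open>F'\<close> to unitary conjugates of the same \<open>B\<close>, then \<open>D\<^sub>i\<close> and \<open>E\<^sub>i\<close> are
both close to unitary conjugates of \<open>g\<^sub>i(B)\<close>, because polynomials commute with unitary conjugation.
Hence one representative per ball of a cover for \<open>x\<close> gives a cover for \<open>y\<close> with no more elements
(\<open>orb_covering_number_microstates_transfer\<close>). None of the tolerances depends on the matrix
size, so the inequality survives the limit superior, infimum and
supremum, and the situation is symmetric in the two systems.

The size-free tolerances are explicit Lipschitz constants, computed by recursion on a syntax tree
(\<open>eval_exp_lipschitz\<close>, \<open>eval_exp_mat_lipschitz\<close>). For this reason the argument runs on a datatype of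
expressions, in which substitution and adjoints are structural, and *-polynomials are translated
into expressions and back (\<open>exp_of_star_poly\<close>, \<open>poly_eval_mat_poly_of_exp\<close>).\<close>

section \<open>Adjoints and the operator norm of matrices\<close>

lemma dim_mat_adjoint [simp]:
  "dim_row (mat_adjoint A) = dim_col A" "dim_col (mat_adjoint A) = dim_row A"
  by (auto simp: mat_adjoint_def)

lemma index_mat_adjoint [simp]:
  fixes A :: "complex mat"
  assumes "i < dim_col A" "j < dim_row A"
  shows "mat_adjoint A $$ (i, j) = cnj (A $$ (j, i))"
  using assms by (simp add: mat_adjoint_def mat_of_rows_index)

lemma mat_adjoint_carrier [simp]:
  "mat_adjoint A \<in> carrier_mat n m \<longleftrightarrow> A \<in> carrier_mat m n"
  unfolding carrier_mat_def by auto

lemma mat_adjoint_adjoint [simp]: "mat_adjoint (mat_adjoint A) = (A :: complex mat)"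
  by (rule eq_matI) simp_all

lemma mat_adjoint_one [simp]: "mat_adjoint (1\<^sub>m n :: complex mat) = 1\<^sub>m n"
  by (rule eq_matI) simp_all

text \<open>Scalar products sum over \<open>{0..<n}\<close>; the entry formulas below use \<open>{..<n}\<close>, the index set in
the definition of the vector norm.\<close>

lemma index_mult_mat_sum:
  "A \<in> carrier_mat m n \<Longrightarrow> B \<in> carrier_mat n k \<Longrightarrow> i < m \<Longrightarrow> j < k \<Longrightarrow>
    (A * B) $$ (i, j) = (\<Sum>l<n. A $$ (i, l) * B $$ (l, j))"
  by (simp add: scalar_prod_def atLeast0LessThan)

lemma index_mult_vec_sum:
  "A \<in> carrier_mat m n \<Longrightarrow> v \<in> carrier_vec n \<Longrightarrow> i < m \<Longrightarrow>
    (A *\<^sub>v v) $ i = (\<Sum>l<n. A $$ (i, l) * v $ l)"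
  by (simp add: scalar_prod_def atLeast0LessThan)

lemma mat_adjoint_mult:
  fixes A B :: "complex mat"
  assumes A: "A \<in> carrier_mat m n" and B: "B \<in> carrier_mat n k"
  shows "mat_adjoint (A * B) = mat_adjoint B * mat_adjoint A"
proof (rule eq_matI)
  fix i j assume "i < dim_row (mat_adjoint B * mat_adjoint A)"
    and "j < dim_col (mat_adjoint B * mat_adjoint A)"
  then have ij: "i < k" "j < m" using assms by simp_all
  have "mat_adjoint (A * B) $$ (i, j) = cnj ((A * B) $$ (j, i))"
    by (rule index_mat_adjoint) (use assms ij in simp_all)
  also have "\<dots> = (\<Sum>l<n. mat_adjoint B $$ (i, l) * mat_adjoint A $$ (l, j))"
    unfolding index_mult_mat_sum[OF A B ij(2,1)]
    using assms ij by (simp add: mult.commute)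
  also have "\<dots> = (mat_adjoint B * mat_adjoint A) $$ (i, j)"
    by (rule index_mult_mat_sum[symmetric]) (use assms ij in simp_all)
  finally show "mat_adjoint (A * B) $$ (i, j) = (mat_adjoint B * mat_adjoint A) $$ (i, j)" .
qed (use assms in simp_all)

lemma mat_adjoint_minus:
  fixes A B :: "complex mat"
  assumes "A \<in> carrier_mat m n" "B \<in> carrier_mat m n"
  shows "mat_adjoint (A - B) = mat_adjoint A - mat_adjoint B"
  by (rule eq_matI) (use assms in auto)

lemma l2_norm_vec_nonneg [simp]: "0 \<le> l2_norm_vec v"
  by (simp add: l2_norm_vec_def)

lemma l2_norm_vec_smult [simp]: "l2_norm_vec (c \<cdot>\<^sub>v v) = cmod c * l2_norm_vec v"
  by (simp add: l2_norm_vec_def L2_set_right_distrib norm_mult cong: L2_set_cong_simp)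

lemma l2_norm_vec_add:
  assumes "v \<in> carrier_vec n" "w \<in> carrier_vec n"
  shows "l2_norm_vec (v + w) \<le> l2_norm_vec v + l2_norm_vec w"
proof -
  have "l2_norm_vec (v + w) \<le> L2_set (\<lambda>i. cmod (v $ i) + cmod (w $ i)) {..<n}"
    unfolding l2_norm_vec_def using assms by (auto intro!: L2_set_mono norm_triangle_ineq)
  also have "\<dots> \<le> l2_norm_vec v + l2_norm_vec w"
    unfolding l2_norm_vec_def using assms L2_set_triangle_ineq by auto
  finally show ?thesis .
qed

text \<open>The sum of the absolute values of all entries is a crude bound for the operator norm. It grows
with the size of the matrix and serves only to make the supremum meaningful.\<close>

lemma op_norm_bdd_above:
  "bdd_above {l2_norm_vec (A *\<^sub>v v) | v. v \<in> carrier_vec (dim_col A) \<and> l2_norm_vec v \<le> 1}"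
proof (rule bdd_aboveI, safe)
  fix v assume v: "v \<in> carrier_vec (dim_col A)" "l2_norm_vec v \<le> 1"
  have vi: "cmod (v $ j) \<le> 1" if "j < dim_col A" for j
    using member_le_L2_set[of "{..<dim_vec v}" j "\<lambda>i. cmod (v $ i)"] v that
    by (auto simp: l2_norm_vec_def)
  have "l2_norm_vec (A *\<^sub>v v) \<le> (\<Sum>i<dim_row A. cmod ((A *\<^sub>v v) $ i))"
    unfolding l2_norm_vec_def dim_mult_mat_vec by (rule L2_set_le_sum) simp
  also have "\<dots> \<le> (\<Sum>i<dim_row A. \<Sum>j<dim_col A. cmod (A $$ (i, j)))"
  proof (rule sum_mono)
    fix i assume "i \<in> {..<dim_row A}"
    then have "(A *\<^sub>v v) $ i = (\<Sum>l<dim_col A. A $$ (i, l) * v $ l)"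
      by (intro index_mult_vec_sum[where m = "dim_row A"]) (use v in auto)
    then show "cmod ((A *\<^sub>v v) $ i) \<le> (\<Sum>j<dim_col A. cmod (A $$ (i, j)))"
      by (auto simp: norm_mult intro!: sum_norm_le mult_left_le vi)
  qed
  finally show "l2_norm_vec (A *\<^sub>v v) \<le> (\<Sum>i<dim_row A. \<Sum>j<dim_col A. cmod (A $$ (i, j)))" .
qed

lemma op_norm_upper:
  "v \<in> carrier_vec (dim_col A) \<Longrightarrow> l2_norm_vec v \<le> 1 \<Longrightarrow> l2_norm_vec (A *\<^sub>v v) \<le> op_norm A"
  unfolding op_norm_def by (rule cSup_upper[OF _ op_norm_bdd_above]) auto

lemma l2_norm_vec_zero [simp]: "l2_norm_vec (0\<^sub>v n) = 0"
  by (simp add: l2_norm_vec_def L2_set_0')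

lemma op_norm_leI:
  assumes "A \<in> carrier_mat m n" "0 \<le> c"
    and "\<And>v. v \<in> carrier_vec n \<Longrightarrow> l2_norm_vec (A *\<^sub>v v) \<le> c * l2_norm_vec v"
  shows "op_norm A \<le> c"
  unfolding op_norm_def
proof (rule cSup_least)
  show "{l2_norm_vec (A *\<^sub>v v) |v. v \<in> carrier_vec (dim_col A) \<and> l2_norm_vec v \<le> 1} \<noteq> {}"
    by (auto intro!: exI[of _ "0\<^sub>v (dim_col A)"])
next
  fix r assume "r \<in> {l2_norm_vec (A *\<^sub>v v) |v. v \<in> carrier_vec (dim_col A) \<and> l2_norm_vec v \<le> 1}"
  then obtain v where v: "r = l2_norm_vec (A *\<^sub>v v)" "v \<in> carrier_vec n" "l2_norm_vec v \<le> 1"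
    using assms(1) by auto
  then show "r \<le> c"
    using assms(3)[of v] mult_left_mono[of "l2_norm_vec v" 1 c] assms(2) by simp
qed

lemma op_norm_nonneg [simp]: "0 \<le> op_norm A"
  using op_norm_upper[of "0\<^sub>v (dim_col A)" A] l2_norm_vec_nonneg[of "A *\<^sub>v 0\<^sub>v (dim_col A)"]
  by (simp del: l2_norm_vec_nonneg)

lemma l2_norm_mult_vec_le:
  assumes "A \<in> carrier_mat m n" "v \<in> carrier_vec n"
  shows "l2_norm_vec (A *\<^sub>v v) \<le> op_norm A * l2_norm_vec v"
proof (cases "l2_norm_vec v = 0")
  case True
  then have "v = 0\<^sub>v n"
    using assms by (auto simp: l2_norm_vec_def L2_set_eq_0_iff)
  then have "A *\<^sub>v v = 0\<^sub>v m" using assms by auto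
  then show ?thesis using True by simp
next
  case False
  \<comment> \<open>Normalise \<open>v\<close> to a unit vector.\<close>
  define t where "t = complex_of_real (1 / l2_norm_vec v)"
  have t: "cmod t = 1 / l2_norm_vec v"
    unfolding t_def norm_of_real by simp
  have "l2_norm_vec (A *\<^sub>v (t \<cdot>\<^sub>v v)) \<le> op_norm A"
    by (rule op_norm_upper) (use assms t False in auto)
  also have "A *\<^sub>v (t \<cdot>\<^sub>v v) = t \<cdot>\<^sub>v (A *\<^sub>v v)"
    using assms by (auto intro!: mult_mat_vec)
  finally show ?thesis
    using False t l2_norm_vec_nonneg[of v]
    by (simp add: field_simps del: l2_norm_vec_nonneg)
qed

lemma op_norm_add_le:
  assumes "A \<in> carrier_mat m n" "B \<in> carrier_mat m n"
  shows "op_norm (A + B) \<le> op_norm A + op_norm B"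
proof (rule op_norm_leI)
  fix v :: "complex vec" assume v: "v \<in> carrier_vec n"
  have "l2_norm_vec ((A + B) *\<^sub>v v) = l2_norm_vec (A *\<^sub>v v + B *\<^sub>v v)"
    using assms v by (simp add: add_mult_distrib_mat_vec)
  also have "\<dots> \<le> l2_norm_vec (A *\<^sub>v v) + l2_norm_vec (B *\<^sub>v v)"
    by (rule l2_norm_vec_add[where n = m]) (use assms v in auto)
  also have "\<dots> \<le> (op_norm A + op_norm B) * l2_norm_vec v"
    using l2_norm_mult_vec_le[OF assms(1) v] l2_norm_mult_vec_le[OF assms(2) v]
    by (simp add: algebra_simps)
  finally show "l2_norm_vec ((A + B) *\<^sub>v v) \<le> (op_norm A + op_norm B) * l2_norm_vec v" .
qed (use assms in auto)

lemma op_norm_smult_le: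
  assumes "A \<in> carrier_mat m n"
  shows "op_norm (c \<cdot>\<^sub>m A) \<le> cmod c * op_norm A"
proof (rule op_norm_leI)
  fix v :: "complex vec" assume v: "v \<in> carrier_vec n"
  have "(c \<cdot>\<^sub>m A) *\<^sub>v v = c \<cdot>\<^sub>v (A *\<^sub>v v)"
    by (rule eq_vecI) (use assms v in \<open>auto simp: scalar_prod_def sum_distrib_left mult.assoc\<close>)
  then show "l2_norm_vec ((c \<cdot>\<^sub>m A) *\<^sub>v v) \<le> cmod c * op_norm A * l2_norm_vec v"
    using l2_norm_mult_vec_le[OF assms v] by (simp add: mult.assoc mult_left_mono)
qed (use assms in auto)

lemma op_norm_mult_le:
  assumes "A \<in> carrier_mat m n" "B \<in> carrier_mat n k"
  shows "op_norm (A * B) \<le> op_norm A * op_norm B"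
proof (rule op_norm_leI)
  fix v :: "complex vec" assume v: "v \<in> carrier_vec k"
  have "l2_norm_vec ((A * B) *\<^sub>v v) = l2_norm_vec (A *\<^sub>v (B *\<^sub>v v))"
    using assms v by simp
  also have "\<dots> \<le> op_norm A * l2_norm_vec (B *\<^sub>v v)"
    by (rule l2_norm_mult_vec_le) (use assms v in auto)
  also have "\<dots> \<le> op_norm A * (op_norm B * l2_norm_vec v)"
    by (rule mult_left_mono) (use l2_norm_mult_vec_le[OF assms(2) v] in auto)
  finally show "l2_norm_vec ((A * B) *\<^sub>v v) \<le> op_norm A * op_norm B * l2_norm_vec v"
    by (simp add: mult.assoc)
qed (use assms in auto)

lemma op_norm_one_le: "op_norm (1\<^sub>m n) \<le> 1"
  by (rule op_norm_leI[where m = n and n = n]) auto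

lemma op_norm_zero [simp]: "op_norm (0\<^sub>m m n) = 0"
proof -
  have "op_norm (0\<^sub>m m n) \<le> 0"
  proof (rule op_norm_leI[where m = m and n = n])
    fix v :: "complex vec" assume "v \<in> carrier_vec n"
    then have "0\<^sub>m m n *\<^sub>v v = 0\<^sub>v m" by auto
    then show "l2_norm_vec (0\<^sub>m m n *\<^sub>v v) \<le> 0 * l2_norm_vec v" by simp
  qed auto
  then show ?thesis using op_norm_nonneg[of "0\<^sub>m m n"] by linarith
qed

lemma l2_norm_vec_square:
  "complex_of_real ((l2_norm_vec v)\<^sup>2) = (\<Sum>i<dim_vec v. v $ i * cnj (v $ i))"
  unfolding l2_norm_vec_def L2_set_def complex_norm_square[symmetric]
  by (simp add: sum_nonneg del: of_real_power of_real_sum add: of_real_sum[symmetric])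

text \<open>With \<open>w = A\<^sup>* v\<close> one has \<open>\<parallel>w\<parallel>\<^sup>2 = \<langle>v, A w\<rangle>\<close>, and Cauchy-Schwarz bounds this by
\<open>\<parallel>v\<parallel> \<parallel>A\<parallel> \<parallel>w\<parallel>\<close>. The constant \<open>1\<close> matters: a bound that depended on the size of the matrix would spoil
the uniformity of the Lipschitz constants for expressions with adjoints.\<close>

lemma op_norm_adjoint_le:
  assumes A: "A \<in> carrier_mat m n"
  shows "op_norm (mat_adjoint A) \<le> op_norm A"
proof (rule op_norm_leI)
  fix v :: "complex vec" assume v: "v \<in> carrier_vec m"
  define w where "w = mat_adjoint A *\<^sub>v v"
  have w: "w \<in> carrier_vec n"
    unfolding w_def by (rule mult_mat_vec_carrier[where nr = n and n = m]) (use A v in auto)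
  have wi: "w $ i = (\<Sum>j<m. cnj (A $$ (j, i)) * v $ j)" if "i < n" for i
    unfolding w_def using A v that by (subst index_mult_vec_sum[of _ n m]) auto
  have "complex_of_real ((l2_norm_vec w)\<^sup>2) = (\<Sum>i<n. \<Sum>j<m. cnj (A $$ (j, i)) * v $ j * cnj (w $ i))"
    using w wi by (subst l2_norm_vec_square) (auto simp: sum_distrib_right)
  also have "\<dots> = (\<Sum>j<m. \<Sum>i<n. cnj (A $$ (j, i)) * v $ j * cnj (w $ i))"
    by (rule sum.swap)
  also have "\<dots> = (\<Sum>j<m. v $ j * cnj ((A *\<^sub>v w) $ j))"
    using A w by (intro sum.cong refl, subst index_mult_vec_sum[of _ m n])
      (auto simp: sum_distrib_left mult_ac)
  finally have eq: "complex_of_real ((l2_norm_vec w)\<^sup>2) = (\<Sum>j<m. v $ j * cnj ((A *\<^sub>v w) $ j))" .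
  have "(l2_norm_vec w)\<^sup>2 = cmod (complex_of_real ((l2_norm_vec w)\<^sup>2))"
    unfolding norm_of_real by simp
  also have "\<dots> \<le> (\<Sum>j<m. \<bar>cmod (v $ j)\<bar> * \<bar>cmod ((A *\<^sub>v w) $ j)\<bar>)"
    unfolding eq by (auto simp: norm_mult intro!: sum_norm_le)
  also have "\<dots> \<le> l2_norm_vec v * l2_norm_vec (A *\<^sub>v w)"
    using L2_set_mult_ineq[of "\<lambda>j. cmod (v $ j)" "\<lambda>j. cmod ((A *\<^sub>v w) $ j)" "{..<m}"] A v
    unfolding l2_norm_vec_def dim_mult_mat_vec by (metis carrier_matD(1) carrier_vecD)
  also have "\<dots> \<le> l2_norm_vec v * (op_norm A * l2_norm_vec w)"
    by (rule mult_left_mono) (use l2_norm_mult_vec_le[OF A w] in auto)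
  finally have "l2_norm_vec w * l2_norm_vec w \<le> (op_norm A * l2_norm_vec v) * l2_norm_vec w"
    by (simp add: power2_eq_square mult_ac)
  moreover have "0 \<le> op_norm A * l2_norm_vec v" by simp
  ultimately have "l2_norm_vec w \<le> op_norm A * l2_norm_vec v"
    using l2_norm_vec_nonneg[of w] by (smt (verit) mult_right_le_imp_le)
  then show "l2_norm_vec (mat_adjoint A *\<^sub>v v) \<le> op_norm A * l2_norm_vec v"
    by (simp add: w_def)
qed (use A in auto)

lemma op_norm_minus_commute:
  assumes "A \<in> carrier_mat m n" "B \<in> carrier_mat m n"
  shows "op_norm (A - B) = op_norm (B - A)"
proof -
  have *: "op_norm (Y - X) \<le> op_norm (X - Y)"
    if "X \<in> carrier_mat m n" "Y \<in> carrier_mat m n" for X Y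
  proof -
    have "Y - X = (-1) \<cdot>\<^sub>m (X - Y)" by (rule eq_matI) (use that in auto)
    then show ?thesis
      using op_norm_smult_le[OF minus_carrier_mat[OF that(2)], of "-1" X] by simp
  qed
  show ?thesis using *[OF assms] *[OF assms(2,1)] by simp
qed

lemma op_norm_minus_triangle:
  assumes "A \<in> carrier_mat m n" "B \<in> carrier_mat m n" "C \<in> carrier_mat m n"
  shows "op_norm (A - C) \<le> op_norm (A - B) + op_norm (B - C)"
proof -
  have "A - C = (A - B) + (B - C)" by (rule eq_matI) (use assms in auto)
  then show ?thesis
    using op_norm_add_le[OF minus_carrier_mat[OF assms(2)] minus_carrier_mat[OF assms(3)], of A B]
    by simp
qed

section \<open>Conjugation by unitaries\<close>

abbreviation conj_mat :: "complex mat \<Rightarrow> complex mat \<Rightarrow> complex mat" where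
  "conj_mat U A \<equiv> U * A * mat_adjoint U"

lemma unitary_matsD:
  assumes "U \<in> unitary_mats n"
  shows "U \<in> carrier_mat n n" "U * mat_adjoint U = 1\<^sub>m n" "mat_adjoint U * U = 1\<^sub>m n"
  using assms by (auto simp: unitary_mats_def)

lemma adjoint_unitary: "U \<in> unitary_mats n \<Longrightarrow> mat_adjoint U \<in> unitary_mats n"
  by (auto simp: unitary_mats_def)

lemma conj_mat_carrier [simp]:
  "U \<in> unitary_mats n \<Longrightarrow> A \<in> carrier_mat n n \<Longrightarrow> conj_mat U A \<in> carrier_mat n n"
  by (auto dest: unitary_matsD)

text \<open>Here \<open>\<parallel>U v\<parallel>\<^sup>2 = \<langle>v, U\<^sup>* U v\<rangle> = \<parallel>v\<parallel>\<^sup>2\<close>.\<close>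

lemma op_norm_unitary_le:
  assumes U: "U \<in> unitary_mats n"
  shows "op_norm U \<le> 1"
proof (rule op_norm_leI)
  note UD = unitary_matsD[OF U]
  show "U \<in> carrier_mat n n" by fact
  fix v :: "complex vec" assume v: "v \<in> carrier_vec n"
  define w where "w = U *\<^sub>v v"
  have w: "w \<in> carrier_vec n" using UD v by (auto simp: w_def)
  have "mat_adjoint U *\<^sub>v w = (mat_adjoint U * U) *\<^sub>v v"
    unfolding w_def using UD(1) v by (intro assoc_mult_mat_vec[symmetric]) auto
  then have aw: "mat_adjoint U *\<^sub>v w = v" using UD v by simp
  have vi: "v $ j = (\<Sum>i<n. cnj (U $$ (i, j)) * w $ i)" if "j < n" for j
  proof -
    have "(mat_adjoint U *\<^sub>v w) $ j = (\<Sum>l<n. mat_adjoint U $$ (j, l) * w $ l)"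
      by (rule index_mult_vec_sum) (use UD(1) w that in auto)
    then show ?thesis using aw UD(1) that by simp
  qed
  have wi: "w $ i = (\<Sum>j<n. U $$ (i, j) * v $ j)" if "i < n" for i
    unfolding w_def using UD(1) v that by (intro index_mult_vec_sum) auto
  have "complex_of_real ((l2_norm_vec w)\<^sup>2) = (\<Sum>i<n. \<Sum>j<n. w $ i * (cnj (U $$ (i, j)) * cnj (v $ j)))"
    using w wi by (subst l2_norm_vec_square) (auto simp: sum_distrib_left)
  also have "\<dots> = (\<Sum>j<n. \<Sum>i<n. w $ i * (cnj (U $$ (i, j)) * cnj (v $ j)))"
    by (rule sum.swap)
  also have "\<dots> = (\<Sum>j<n. v $ j * cnj (v $ j))"
    by (intro sum.cong refl) (auto simp: vi sum_distrib_right mult_ac simp del: cnj_sum)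
  also have "\<dots> = complex_of_real ((l2_norm_vec v)\<^sup>2)"
    using v by (subst l2_norm_vec_square) auto
  finally have "(l2_norm_vec w)\<^sup>2 = (l2_norm_vec v)\<^sup>2"
    by (simp only: of_real_eq_iff)
  then show "l2_norm_vec (U *\<^sub>v v) \<le> 1 * l2_norm_vec v"
    by (simp add: w_def)
qed simp

lemma op_norm_conj_le:
  assumes U: "U \<in> unitary_mats n" and A: "A \<in> carrier_mat n n"
  shows "op_norm (conj_mat U A) \<le> op_norm A"
proof -
  note UD = unitary_matsD[OF U]
  have "op_norm (conj_mat U A) \<le> op_norm (U * A) * op_norm (mat_adjoint U)"
    by (rule op_norm_mult_le[where m = n and n = n and k = n]) (use UD(1) A in auto)
  also have "\<dots> \<le> op_norm (U * A)"
    using op_norm_unitary_le[OF adjoint_unitary[OF U]] by (simp add: mult_left_le)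
  also have "\<dots> \<le> op_norm U * op_norm A"
    by (rule op_norm_mult_le[where m = n and n = n and k = n]) (use UD(1) A in auto)
  also have "\<dots> \<le> op_norm A"
    using op_norm_unitary_le[OF U] by (simp add: mult_left_le_one_le)
  finally show ?thesis .
qed

lemma conj_mat_add:
  assumes "U \<in> unitary_mats N" "A \<in> carrier_mat N N" "B \<in> carrier_mat N N"
  shows "conj_mat U (A + B) = conj_mat U A + conj_mat U B"
  using assms unitary_matsD[OF assms(1)]
  by (simp add: mult_add_distrib_mat[of _ N N _ N] add_mult_distrib_mat[of _ N N _ _ N])

lemma conj_mat_smult:
  assumes "U \<in> unitary_mats N" "A \<in> carrier_mat N N"
  shows "conj_mat U (c \<cdot>\<^sub>m A) = c \<cdot>\<^sub>m conj_mat U A"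
  using assms unitary_matsD[OF assms(1)] by (simp add: mult_smult_distrib[of _ N N _ N]
      mult_smult_assoc_mat[of _ N N _ N])

lemma mult_unitary_cancel:
  assumes U: "U \<in> unitary_mats N" and B: "B \<in> carrier_mat N k"
  shows "U * (mat_adjoint U * B) = B" "mat_adjoint U * (U * B) = B"
proof -
  note UD = unitary_matsD[OF U]
  have a: "mat_adjoint U \<in> carrier_mat N N" using UD(1) by simp
  show "U * (mat_adjoint U * B) = B"
    using assoc_mult_mat[OF UD(1) a B] UD(2) B by simp
  show "mat_adjoint U * (U * B) = B"
    using assoc_mult_mat[OF a UD(1) B] UD(3) B by simp
qed

text \<open>In the product of the two conjugates the inner factors \<open>U\<^sup>* U\<close> cancel.\<close>

lemma conj_mat_mult:
  assumes U: "U \<in> unitary_mats N" and A: "A \<in> carrier_mat N N" and B: "B \<in> carrier_mat N N"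
  shows "conj_mat U (A * B) = conj_mat U A * conj_mat U B"
proof -
  note UD = unitary_matsD[OF U]
  have a: "mat_adjoint U \<in> carrier_mat N N" using UD(1) by simp
  have "conj_mat U A * conj_mat U B = (U * A) * (mat_adjoint U * (U * B * mat_adjoint U))"
    using UD(1) a A B by (intro assoc_mult_mat[of _ N N _ N _ N]) auto
  also have "mat_adjoint U * (U * B * mat_adjoint U) = B * mat_adjoint U"
    using UD(1) a B mult_unitary_cancel(2)[OF U mult_carrier_mat[OF B a]]
    by (simp add: assoc_mult_mat[of U N N B N _ N])
  also have "(U * A) * (B * mat_adjoint U) = (U * A * B) * mat_adjoint U"
    using UD(1) a A B by (intro assoc_mult_mat[symmetric, of _ N N _ N _ N]) auto
  also have "U * A * B = U * (A * B)"
    using UD(1) A B by (intro assoc_mult_mat)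
  finally show ?thesis by simp
qed

lemma conj_mat_adjoint:
  assumes U: "U \<in> unitary_mats N" and A: "A \<in> carrier_mat N N"
  shows "conj_mat U (mat_adjoint A) = mat_adjoint (conj_mat U A)"
proof -
  note UD = unitary_matsD[OF U]
  have a: "mat_adjoint U \<in> carrier_mat N N" "mat_adjoint A \<in> carrier_mat N N"
    using UD(1) A by simp_all
  have "mat_adjoint (conj_mat U A) = mat_adjoint (mat_adjoint U) * mat_adjoint (U * A)"
    using UD(1) a A by (intro mat_adjoint_mult[of _ N N _ N]) auto
  also have "\<dots> = U * (mat_adjoint A * mat_adjoint U)"
    using UD(1) A by (simp add: mat_adjoint_mult[of _ N N _ N])
  also have "\<dots> = conj_mat U (mat_adjoint A)"
    using UD(1) a by (intro assoc_mult_mat[symmetric])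
  finally show ?thesis by simp
qed

lemma mult_unitary_mats:
  assumes U: "U \<in> unitary_mats N" and V: "V \<in> unitary_mats N"
  shows "U * V \<in> unitary_mats N"
proof -
  note UD = unitary_matsD[OF U] and VD = unitary_matsD[OF V]
  have a: "mat_adjoint U \<in> carrier_mat N N" "mat_adjoint V \<in> carrier_mat N N"
    using UD VD by simp_all
  have adj: "mat_adjoint (U * V) = mat_adjoint V * mat_adjoint U"
    by (rule mat_adjoint_mult[OF UD(1) VD(1)])
  have "U * V * (mat_adjoint V * mat_adjoint U) = U * (V * (mat_adjoint V * mat_adjoint U))"
    using UD VD a by (intro assoc_mult_mat[of _ N N _ N _ N]) auto
  moreover have "mat_adjoint V * mat_adjoint U * (U * V) = mat_adjoint V * (mat_adjoint U * (U * V))"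
    using UD VD a by (intro assoc_mult_mat[of _ N N _ N _ N]) auto
  ultimately show ?thesis
    using UD VD a mult_unitary_cancel[OF V a(1)] mult_unitary_cancel[OF U VD(1)]
    by (simp add: unitary_mats_def adj)
qed

lemma conj_mat_conj_mat:
  assumes U: "U \<in> unitary_mats N" and V: "V \<in> unitary_mats N" and A: "A \<in> carrier_mat N N"
  shows "conj_mat (U * V) A = conj_mat U (conj_mat V A)"
proof -
  note UD = unitary_matsD[OF U] and VD = unitary_matsD[OF V]
  have a: "mat_adjoint U \<in> carrier_mat N N" "mat_adjoint V \<in> carrier_mat N N"
    using UD VD by simp_all
  have "conj_mat (U * V) A = (U * V * A) * (mat_adjoint V * mat_adjoint U)"
    by (simp add: mat_adjoint_mult[OF UD(1) VD(1)])
  also have "\<dots> = U * V * A * mat_adjoint V * mat_adjoint U"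
    using UD(1) VD(1) a A by (intro assoc_mult_mat[symmetric, of _ N N _ N _ N]) auto
  also have "U * V * A * mat_adjoint V = U * (V * A) * mat_adjoint V"
    using UD(1) VD(1) A by (simp add: assoc_mult_mat[of U N N V N A N])
  also have "U * (V * A) * mat_adjoint V = U * (V * A * mat_adjoint V)"
    using UD(1) VD(1) a A by (intro assoc_mult_mat[of _ N N _ N _ N]) auto
  finally show ?thesis .
qed

text \<open>Two matrices that are near conjugates of the same \<open>G\<close> are near each other up to conjugation: the
second one, moved by \<open>U V\<^sup>*\<close>, is compared with \<open>U G U\<^sup>* = (U V\<^sup>*) (V G V\<^sup>*) (U V\<^sup>*)\<^sup>*\<close>, and
conjugation does not increase the norm.\<close>

lemma op_norm_minus_conj_le:
  assumes U: "U \<in> unitary_mats N" and V: "V \<in> unitary_mats N"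
    and D: "D \<in> carrier_mat N N" and E: "E \<in> carrier_mat N N" and G: "G \<in> carrier_mat N N"
  shows "op_norm (D - conj_mat (U * mat_adjoint V) E)
    \<le> op_norm (D - conj_mat U G) + op_norm (E - conj_mat V G)"
proof -
  note V' = adjoint_unitary[OF V]
  have W: "U * mat_adjoint V \<in> unitary_mats N" using U V' by (rule mult_unitary_mats)
  have "conj_mat (mat_adjoint V) (conj_mat V G) = conj_mat (mat_adjoint V * V) G"
    by (rule conj_mat_conj_mat[symmetric, OF V' V G])
  also have "\<dots> = G" using unitary_matsD[OF V] G by simp
  finally have "conj_mat U G = conj_mat (U * mat_adjoint V) (conj_mat V G)"
    using conj_mat_conj_mat[OF U V', of "conj_mat V G"] V G by simp
  moreover have "conj_mat (U * mat_adjoint V) (conj_mat V G - E) =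
      conj_mat (U * mat_adjoint V) (conj_mat V G) - conj_mat (U * mat_adjoint V) E"
  proof -
    have "conj_mat V G - E = conj_mat V G + (-1) \<cdot>\<^sub>m E"
      by (rule eq_matI) (use E in simp_all)
    moreover have "X - Y = X + (-1) \<cdot>\<^sub>m Y" if "X \<in> carrier_mat N N" "Y \<in> carrier_mat N N"
      for X Y :: "complex mat"
      by (rule eq_matI) (use that in simp_all)
    ultimately show ?thesis
      using V G E W by (simp add: conj_mat_add[OF W] conj_mat_smult[OF W])
  qed
  ultimately have "op_norm (conj_mat U G - conj_mat (U * mat_adjoint V) E)
      = op_norm (conj_mat (U * mat_adjoint V) (conj_mat V G - E))" by simp
  also have "\<dots> \<le> op_norm (conj_mat V G - E)"
    using E by (intro op_norm_conj_le[OF W] minus_carrier_mat)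
  also have "\<dots> = op_norm (E - conj_mat V G)"
    using V G E by (intro op_norm_minus_commute) auto
  finally show ?thesis
    using op_norm_minus_triangle[OF D conj_mat_carrier[OF U G] conj_mat_carrier[OF W E]] by simp
qed

section \<open>Elementary identities in C*-algebras\<close>

lemma scaleC_zero_left [simp]: "0 *\<^sub>C x = (0 :: 'a::cstar_algebra)"
  using scaleC_add_left[of 0 0 x] by simp

lemma scaleC_zero_right [simp]: "c *\<^sub>C 0 = (0 :: 'a::cstar_algebra)"
  using scaleC_add_right[of c 0 "0::'a"] by simp

lemma scaleC_diff_right: "c *\<^sub>C (x - y) = c *\<^sub>C x - c *\<^sub>C (y :: 'a::cstar_algebra)"
  using scaleC_add_right[of c "x - y" y] by (simp add: algebra_simps)

lemma scaleC_one [simp]: "1 *\<^sub>C x = (x :: 'a::cstar_algebra)"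
  using scaleR_scaleC[of 1 x] by simp

lemma star_zero [simp]: "star 0 = (0 :: 'a::cstar_algebra)"
  using star_add[of 0 "0::'a"] by simp

lemma star_diff: "star (x - y) = star x - star (y :: 'a::cstar_algebra)"
  using star_add[of "x - y" y] by (simp add: algebra_simps)

lemma star_sum: "star (\<Sum>i\<in>S. f i) = (\<Sum>i\<in>S. star (f i :: 'a::cstar_algebra))"
  by (induction S rule: infinite_finite_induct) (simp_all add: star_add)

lemma star_one [simp]: "star 1 = (1 :: 'a::cstar_algebra)"
  using star_mult[of "star 1" "1::'a"] by (simp add: star_star)

text \<open>The C*-identity gives \<open>\<parallel>y\<parallel>\<^sup>2 = \<parallel>y\<^sup>* y\<parallel> \<le> \<parallel>y\<^sup>*\<parallel> \<parallel>y\<parallel>\<close>, for \<open>y = x\<close> and for \<open>y = x\<^sup>*\<close>.\<close>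

lemma norm_star [simp]: "norm (star x) = norm (x :: 'a::cstar_algebra)"
proof -
  have le: "norm y \<le> norm (star y)" for y :: 'a
  proof (cases "norm y = 0")
    case False
    have "norm y * norm y \<le> norm (star y) * norm y"
      using norm_star_mult[of y] norm_mult_ineq[of "star y" y] by (simp add: power2_eq_square)
    then show ?thesis using False by (simp add: mult_le_cancel_right)
  qed simp
  show ?thesis using le[of x] le[of "star x"] by (simp add: star_star)
qed

text \<open>Applied to the unit, the C*-identity reads \<open>\<parallel>1\<parallel> = \<parallel>1\<parallel>\<^sup>2\<close>. The value \<open>0\<close> occurs in the zero
algebra.\<close>

lemma norm_one_le: "norm (1 :: 'a::cstar_algebra) \<le> 1"
proof (cases "norm (1::'a) = 0")
  case False
  then show ?thesis using norm_star_mult[of "1::'a"] by (simp add: power2_eq_square)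
qed simp

section \<open>Expressions in noncommuting variables and their Lipschitz bounds\<close>

text \<open>For syntax trees, substitution, norm bounds and the passage to unitary conjugates are structural
inductions; for families of coefficients indexed by words each of them would be a manipulation of
nested sums.\<close>

datatype (vars: 'i) nc_exp =
    NVar 'i
  | NOne
  | NPlus "'i nc_exp" "'i nc_exp"
  | NTimes "'i nc_exp" "'i nc_exp"
  | NScale complex "'i nc_exp"
  | NStar "'i nc_exp"

primrec eval_exp :: "('i \<Rightarrow> 'a::cstar_algebra) \<Rightarrow> 'i nc_exp \<Rightarrow> 'a" where
  "eval_exp x (NVar i) = x i"
| "eval_exp x NOne = 1"
| "eval_exp x (NPlus e f) = eval_exp x e + eval_exp x f"
| "eval_exp x (NTimes e f) = eval_exp x e * eval_exp x f"
| "eval_exp x (NScale c e) = c *\<^sub>C eval_exp x e"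
| "eval_exp x (NStar e) = star (eval_exp x e)"

primrec eval_exp_mat :: "nat \<Rightarrow> ('i \<Rightarrow> complex mat) \<Rightarrow> 'i nc_exp \<Rightarrow> complex mat" where
  "eval_exp_mat N A (NVar i) = A i"
| "eval_exp_mat N A NOne = 1\<^sub>m N"
| "eval_exp_mat N A (NPlus e f) = eval_exp_mat N A e + eval_exp_mat N A f"
| "eval_exp_mat N A (NTimes e f) = eval_exp_mat N A e * eval_exp_mat N A f"
| "eval_exp_mat N A (NScale c e) = c \<cdot>\<^sub>m eval_exp_mat N A e"
| "eval_exp_mat N A (NStar e) = mat_adjoint (eval_exp_mat N A e)"

lemma finite_vars [simp]: "finite (vars e)"
  by (induction e) auto

lemma eval_exp_mat_carrier:
  "(\<And>i. i \<in> vars e \<Longrightarrow> A i \<in> carrier_mat N N) \<Longrightarrow> eval_exp_mat N A e \<in> carrier_mat N N"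
  by (induction e) auto

primrec subst_exp :: "('i \<Rightarrow> 'j nc_exp) \<Rightarrow> 'i nc_exp \<Rightarrow> 'j nc_exp" where
  "subst_exp s (NVar i) = s i"
| "subst_exp s NOne = NOne"
| "subst_exp s (NPlus e f) = NPlus (subst_exp s e) (subst_exp s f)"
| "subst_exp s (NTimes e f) = NTimes (subst_exp s e) (subst_exp s f)"
| "subst_exp s (NScale c e) = NScale c (subst_exp s e)"
| "subst_exp s (NStar e) = NStar (subst_exp s e)"

lemma vars_subst_exp: "vars (subst_exp s e) = (\<Union>i\<in>vars e. vars (s i))"
  by (induction e) auto

lemma eval_subst_exp: "eval_exp x (subst_exp s e) = eval_exp (\<lambda>i. eval_exp x (s i)) e"
  by (induction e) auto

lemma eval_subst_exp_mat:
  "eval_exp_mat N A (subst_exp s e) = eval_exp_mat N (\<lambda>i. eval_exp_mat N A (s i)) e"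
  by (induction e) auto

lemma eval_exp_mat_cong:
  "(\<And>i. i \<in> vars e \<Longrightarrow> A i = B i) \<Longrightarrow> eval_exp_mat N A e = eval_exp_mat N B e"
  by (induction e) auto

text \<open>The bound and the Lipschitz constant refer to tuples whose entries have norm at most \<open>C\<close>. They are
read off the syntax tree, hence are the same for the C*-algebra and for matrices of every size.\<close>

primrec exp_bound :: "real \<Rightarrow> 'i nc_exp \<Rightarrow> real" where
  "exp_bound C (NVar i) = C"
| "exp_bound C NOne = 1"
| "exp_bound C (NPlus e f) = exp_bound C e + exp_bound C f"
| "exp_bound C (NTimes e f) = exp_bound C e * exp_bound C f"
| "exp_bound C (NScale c e) = cmod c * exp_bound C e"
| "exp_bound C (NStar e) = exp_bound C e"

primrec exp_lip :: "real \<Rightarrow> 'i nc_exp \<Rightarrow> real" where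
  "exp_lip C (NVar i) = 1"
| "exp_lip C NOne = 0"
| "exp_lip C (NPlus e f) = exp_lip C e + exp_lip C f"
| "exp_lip C (NTimes e f) = exp_bound C e * exp_lip C f + exp_lip C e * exp_bound C f"
| "exp_lip C (NScale c e) = cmod c * exp_lip C e"
| "exp_lip C (NStar e) = exp_lip C e"

lemma exp_bound_nonneg: "0 \<le> C \<Longrightarrow> 0 \<le> exp_bound C e"
  by (induction e) auto

lemma exp_lip_nonneg: "0 \<le> C \<Longrightarrow> 0 \<le> exp_lip C e"
  by (induction e) (auto simp: exp_bound_nonneg)

lemma norm_eval_exp_le:
  assumes "0 \<le> C" "\<And>i. i \<in> vars e \<Longrightarrow> norm (x i) \<le> C"
  shows "norm (eval_exp x e) \<le> exp_bound C e"
  using assms(2)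
proof (induction e)
  case (NPlus e f)
  then show ?case using norm_triangle_ineq[of "eval_exp x e" "eval_exp x f"] by force
next
  case (NTimes e f)
  have "norm (eval_exp x e * eval_exp x f) \<le> norm (eval_exp x e) * norm (eval_exp x f)"
    by (rule norm_mult_ineq)
  also have "\<dots> \<le> exp_bound C e * exp_bound C f"
    by (rule mult_mono) (use NTimes assms(1) in \<open>auto simp: exp_bound_nonneg\<close>)
  finally show ?case by simp
qed (auto simp: norm_one_le norm_scaleC mult_left_mono)

text \<open>The case of products uses \<open>x\<^sub>1 x\<^sub>2 - y\<^sub>1 y\<^sub>2 = x\<^sub>1 (x\<^sub>2 - y\<^sub>2) + (x\<^sub>1 - y\<^sub>1) y\<^sub>2\<close>.\<close>

lemma eval_exp_lipschitz:
  assumes C: "0 \<le> C"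
    and "\<And>i. i \<in> vars e \<Longrightarrow> norm (x i) \<le> C" "\<And>i. i \<in> vars e \<Longrightarrow> norm (y i) \<le> C"
    and "\<And>i. i \<in> vars e \<Longrightarrow> norm (x i - y i) \<le> \<eta>"
  shows "norm (eval_exp x e - eval_exp y e) \<le> exp_lip C e * \<eta>"
  using assms(2-)
proof (induction e)
  case (NPlus e f)
  have "eval_exp x (NPlus e f) - eval_exp y (NPlus e f) =
      (eval_exp x e - eval_exp y e) + (eval_exp x f - eval_exp y f)" by simp
  also have "norm \<dots> \<le> norm (eval_exp x e - eval_exp y e) + norm (eval_exp x f - eval_exp y f)"
    by (rule norm_triangle_ineq)
  also have "\<dots> \<le> exp_lip C e * \<eta> + exp_lip C f * \<eta>"
    by (rule add_mono) (use NPlus in auto)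
  finally show ?case by (simp add: algebra_simps)
next
  case (NTimes e f)
  have "eval_exp x (NTimes e f) - eval_exp y (NTimes e f) =
      eval_exp x e * (eval_exp x f - eval_exp y f) + (eval_exp x e - eval_exp y e) * eval_exp y f"
    by (simp add: algebra_simps)
  also have "norm \<dots> \<le> norm (eval_exp x e) * norm (eval_exp x f - eval_exp y f)
      + norm (eval_exp x e - eval_exp y e) * norm (eval_exp y f)"
    by (intro norm_triangle_le add_mono norm_mult_ineq)
  also have "\<dots> \<le> exp_bound C e * (exp_lip C f * \<eta>) + (exp_lip C e * \<eta>) * exp_bound C f"
  proof (intro add_mono mult_mono)
    show "norm (eval_exp x e) \<le> exp_bound C e" "norm (eval_exp y f) \<le> exp_bound C f"
      by (rule norm_eval_exp_le; use NTimes C in auto)+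
    show e: "norm (eval_exp x e - eval_exp y e) \<le> exp_lip C e * \<eta>"
      and f: "norm (eval_exp x f - eval_exp y f) \<le> exp_lip C f * \<eta>"
      using NTimes by auto
    show "0 \<le> exp_lip C e * \<eta>" using e norm_ge_zero order_trans by blast
  qed (use C in \<open>auto simp: exp_bound_nonneg\<close>)
  finally show ?case by (simp add: algebra_simps)
next
  case (NScale c e)
  have "norm (c *\<^sub>C (eval_exp x e - eval_exp y e)) \<le> cmod c * (exp_lip C e * \<eta>)"
    unfolding norm_scaleC by (rule mult_left_mono) (use NScale in auto)
  then show ?case by (simp add: scaleC_diff_right mult.assoc)
next
  case (NStar e)
  then show ?case by (simp flip: star_diff)
qed auto

lemma op_norm_eval_exp_mat_le:
  assumes "0 \<le> C" "\<And>i. i \<in> vars e \<Longrightarrow> A i \<in> carrier_mat N N"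
    and "\<And>i. i \<in> vars e \<Longrightarrow> op_norm (A i) \<le> C"
  shows "op_norm (eval_exp_mat N A e) \<le> exp_bound C e"
  using assms(2,3)
proof (induction e)
  case (NPlus e f)
  have "op_norm (eval_exp_mat N A e + eval_exp_mat N A f) \<le>
      op_norm (eval_exp_mat N A e) + op_norm (eval_exp_mat N A f)"
    by (rule op_norm_add_le; rule eval_exp_mat_carrier; use NPlus in auto)
  also have "\<dots> \<le> exp_bound C e + exp_bound C f"
    by (rule add_mono) (use NPlus in auto)
  finally show ?case by simp
next
  case (NTimes e f)
  have "op_norm (eval_exp_mat N A e * eval_exp_mat N A f) \<le>
      op_norm (eval_exp_mat N A e) * op_norm (eval_exp_mat N A f)"
    by (rule op_norm_mult_le; rule eval_exp_mat_carrier; use NTimes in auto)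
  also have "\<dots> \<le> exp_bound C e * exp_bound C f"
    by (rule mult_mono) (use NTimes assms(1) in \<open>auto simp: exp_bound_nonneg\<close>)
  finally show ?case by simp
next
  case (NScale c e)
  have "op_norm (c \<cdot>\<^sub>m eval_exp_mat N A e) \<le> cmod c * op_norm (eval_exp_mat N A e)"
    by (rule op_norm_smult_le, rule eval_exp_mat_carrier) (use NScale in auto)
  also have "\<dots> \<le> cmod c * exp_bound C e"
    by (rule mult_left_mono) (use NScale in auto)
  finally show ?case by simp
next
  case (NStar e)
  have "op_norm (mat_adjoint (eval_exp_mat N A e)) \<le> op_norm (eval_exp_mat N A e)"
    by (rule op_norm_adjoint_le, rule eval_exp_mat_carrier) (use NStar in auto)
  then show ?case using NStar by fastforce
qed (auto simp: op_norm_one_le)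

lemma eval_exp_mat_lipschitz:
  assumes C: "0 \<le> C"
    and "\<And>i. i \<in> vars e \<Longrightarrow> A i \<in> carrier_mat N N" "\<And>i. i \<in> vars e \<Longrightarrow> B i \<in> carrier_mat N N"
    and "\<And>i. i \<in> vars e \<Longrightarrow> op_norm (A i) \<le> C" "\<And>i. i \<in> vars e \<Longrightarrow> op_norm (B i) \<le> C"
    and "\<And>i. i \<in> vars e \<Longrightarrow> op_norm (A i - B i) \<le> \<eta>"
  shows "op_norm (eval_exp_mat N A e - eval_exp_mat N B e) \<le> exp_lip C e * \<eta>"
  using assms(2-)
proof (induction e)
  case NOne
  have "(1\<^sub>m N :: complex mat) - 1\<^sub>m N = 0\<^sub>m N N" by (rule eq_matI) auto
  then show ?case by (simp only: eval_exp_mat.simps exp_lip.simps op_norm_zero mult_zero_left order.refl)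
next
  case (NPlus e f)
  have car: "eval_exp_mat N A e \<in> carrier_mat N N" "eval_exp_mat N A f \<in> carrier_mat N N"
    "eval_exp_mat N B e \<in> carrier_mat N N" "eval_exp_mat N B f \<in> carrier_mat N N"
    by (rule eval_exp_mat_carrier; use NPlus in auto)+
  have "eval_exp_mat N A (NPlus e f) - eval_exp_mat N B (NPlus e f) =
      (eval_exp_mat N A e - eval_exp_mat N B e) + (eval_exp_mat N A f - eval_exp_mat N B f)"
    by (rule eq_matI) (use car in auto)
  also have "op_norm \<dots> \<le> op_norm (eval_exp_mat N A e - eval_exp_mat N B e)
      + op_norm (eval_exp_mat N A f - eval_exp_mat N B f)"
    by (rule op_norm_add_le[where m = N and n = N]) (use car in \<open>auto intro: minus_carrier_mat\<close>)
  also have "\<dots> \<le> exp_lip C e * \<eta> + exp_lip C f * \<eta>"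
    by (rule add_mono) (use NPlus in auto)
  finally show ?case by (simp add: algebra_simps)
next
  case (NTimes e f)
  have car: "eval_exp_mat N A e \<in> carrier_mat N N" "eval_exp_mat N A f \<in> carrier_mat N N"
    "eval_exp_mat N B e \<in> carrier_mat N N" "eval_exp_mat N B f \<in> carrier_mat N N"
    by (rule eval_exp_mat_carrier; use NTimes in auto)+
  have car': "eval_exp_mat N A e - eval_exp_mat N B e \<in> carrier_mat N N"
    "eval_exp_mat N A f - eval_exp_mat N B f \<in> carrier_mat N N"
    using car by (auto intro: minus_carrier_mat)
  have "eval_exp_mat N A e * (eval_exp_mat N A f - eval_exp_mat N B f)
      = eval_exp_mat N A e * eval_exp_mat N A f - eval_exp_mat N A e * eval_exp_mat N B f"
    using car by (intro mult_minus_distrib_mat)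
  moreover have "(eval_exp_mat N A e - eval_exp_mat N B e) * eval_exp_mat N B f
      = eval_exp_mat N A e * eval_exp_mat N B f - eval_exp_mat N B e * eval_exp_mat N B f"
    using car by (intro minus_mult_distrib_mat)
  ultimately have "op_norm (eval_exp_mat N A (NTimes e f) - eval_exp_mat N B (NTimes e f)) \<le>
      op_norm (eval_exp_mat N A e * (eval_exp_mat N A f - eval_exp_mat N B f))
      + op_norm ((eval_exp_mat N A e - eval_exp_mat N B e) * eval_exp_mat N B f)"
    using op_norm_minus_triangle[OF mult_carrier_mat[OF car(1,2)] mult_carrier_mat[OF car(1,4)]
        mult_carrier_mat[OF car(3,4)]] by simp
  also have "\<dots> \<le> op_norm (eval_exp_mat N A e) * op_norm (eval_exp_mat N A f - eval_exp_mat N B f)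
      + op_norm (eval_exp_mat N A e - eval_exp_mat N B e) * op_norm (eval_exp_mat N B f)"
    by (intro add_mono op_norm_mult_le[OF car(1) car'(2)] op_norm_mult_le[OF car'(1) car(4)])
  also have "\<dots> \<le> exp_bound C e * (exp_lip C f * \<eta>) + (exp_lip C e * \<eta>) * exp_bound C f"
  proof (intro add_mono mult_mono)
    show "op_norm (eval_exp_mat N A e) \<le> exp_bound C e" "op_norm (eval_exp_mat N B f) \<le> exp_bound C f"
      by (rule op_norm_eval_exp_mat_le; use NTimes C in auto)+
    show e: "op_norm (eval_exp_mat N A e - eval_exp_mat N B e) \<le> exp_lip C e * \<eta>"
      and f: "op_norm (eval_exp_mat N A f - eval_exp_mat N B f) \<le> exp_lip C f * \<eta>"
      using NTimes by auto
    show "0 \<le> exp_lip C e * \<eta>" using e op_norm_nonneg order_trans by blast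
  qed (use C in \<open>auto simp: exp_bound_nonneg\<close>)
  finally show ?case by (simp add: algebra_simps)
next
  case (NScale c e)
  have car: "eval_exp_mat N A e \<in> carrier_mat N N" "eval_exp_mat N B e \<in> carrier_mat N N"
    by (rule eval_exp_mat_carrier; use NScale in auto)+
  have "c \<cdot>\<^sub>m eval_exp_mat N A e - c \<cdot>\<^sub>m eval_exp_mat N B e
      = c \<cdot>\<^sub>m (eval_exp_mat N A e - eval_exp_mat N B e)"
    by (rule eq_matI) (use car in \<open>auto simp: algebra_simps\<close>)
  also have "op_norm \<dots> \<le> cmod c * op_norm (eval_exp_mat N A e - eval_exp_mat N B e)"
    using car by (intro op_norm_smult_le minus_carrier_mat)
  also have "\<dots> \<le> cmod c * (exp_lip C e * \<eta>)"
    by (rule mult_left_mono) (use NScale in auto)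
  finally show ?case by (simp add: mult.assoc)
next
  case (NStar e)
  have car: "eval_exp_mat N A e \<in> carrier_mat N N" "eval_exp_mat N B e \<in> carrier_mat N N"
    by (rule eval_exp_mat_carrier; use NStar in auto)+
  have "op_norm (mat_adjoint (eval_exp_mat N A e - eval_exp_mat N B e))
      \<le> op_norm (eval_exp_mat N A e - eval_exp_mat N B e)"
    using car by (intro op_norm_adjoint_le minus_carrier_mat)
  also have "\<dots> \<le> exp_lip C e * \<eta>" using NStar by auto
  finally show ?case using car by (simp add: mat_adjoint_minus)
qed auto

text \<open>Conjugation by a unitary is a unital *-homomorphism, so it commutes with every expression.\<close>

lemma eval_exp_mat_conj:
  assumes U: "U \<in> unitary_mats N" and "\<And>i. i \<in> vars e \<Longrightarrow> A i \<in> carrier_mat N N"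
  shows "eval_exp_mat N (\<lambda>i. conj_mat U (A i)) e = conj_mat U (eval_exp_mat N A e)"
  using assms(2)
proof (induction e)
  case NOne
  show ?case using unitary_matsD[OF U] by simp
next
  case (NPlus e f)
  then show ?case by (simp add: conj_mat_add[OF U] eval_exp_mat_carrier)
next
  case (NTimes e f)
  then show ?case by (simp add: conj_mat_mult[OF U] eval_exp_mat_carrier)
next
  case (NScale c e)
  then show ?case by (simp add: conj_mat_smult[OF U] eval_exp_mat_carrier)
next
  case (NStar e)
  then show ?case by (simp add: conj_mat_adjoint[OF U] eval_exp_mat_carrier)
qed simp

section \<open>Expressions and *-polynomials define the same functions\<close>

text \<open>Both evaluations of a *-polynomial are instances: in the algebra \<open>\<phi>\<close> is the value of a word, and
for matrices, which are evaluated entry by entry, \<open>\<phi>\<close> is a fixed entry of the value of a word and the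
coefficients act on the C*-algebra of complex numbers.\<close>

definition lincomb :: "('w \<Rightarrow> 'a::cstar_algebra) \<Rightarrow> ('w \<Rightarrow>\<^sub>0 complex) \<Rightarrow> 'a" where
  "lincomb \<phi> P = (\<Sum>w\<in>Poly_Mapping.keys P. Poly_Mapping.lookup P w *\<^sub>C \<phi> w)"

lemma lincomb_superset:
  assumes "finite S" "Poly_Mapping.keys P \<subseteq> S"
  shows "lincomb \<phi> P = (\<Sum>w\<in>S. Poly_Mapping.lookup P w *\<^sub>C \<phi> w)"
  unfolding lincomb_def
  by (rule sum.mono_neutral_left) (use assms in \<open>auto simp: in_keys_iff\<close>)

lemma lincomb_zero [simp]: "lincomb \<phi> 0 = 0"
  by (simp add: lincomb_def)

lemma lincomb_add [simp]: "lincomb \<phi> (P + Q) = lincomb \<phi> P + lincomb \<phi> Q"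
proof -
  let ?S = "Poly_Mapping.keys P \<union> Poly_Mapping.keys Q"
  have "lincomb \<phi> (P + Q) = (\<Sum>w\<in>?S. Poly_Mapping.lookup (P + Q) w *\<^sub>C \<phi> w)"
    by (rule lincomb_superset) (use keys_add[of P Q] in auto)
  also have "\<dots> = lincomb \<phi> P + lincomb \<phi> Q"
    by (simp add: lincomb_superset[of ?S P] lincomb_superset[of ?S Q] lookup_add
        scaleC_add_left sum.distrib)
  finally show ?thesis .
qed

lemma lincomb_single [simp]: "lincomb \<phi> (Poly_Mapping.single w c) = c *\<^sub>C \<phi> w"
  by (simp add: lincomb_def)

lemma lincomb_sum [simp]: "lincomb \<phi> (\<Sum>i\<in>S. P i) = (\<Sum>i\<in>S. lincomb \<phi> (P i))"
  by (induction S rule: infinite_finite_induct) simp_all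

abbreviation word_eval :: "('i \<Rightarrow> 'a::cstar_algebra) \<Rightarrow> 'i letter list \<Rightarrow> 'a" where
  "word_eval x w \<equiv> prod_list (map (letter_eval x) w)"

lemma poly_eval_lincomb: "poly_eval x P = lincomb (word_eval x) P"
  by (simp add: poly_eval_def lincomb_def)

lemma poly_eval_mat_lincomb:
  "poly_eval_mat N A P = mat N N (\<lambda>(r, s). lincomb (\<lambda>w. word_eval_mat N A w $$ (r, s)) P)"
  by (simp add: poly_eval_mat_def lincomb_def scaleC_complex_def)

lemma poly_eval_mat_carrier [simp]: "poly_eval_mat N A P \<in> carrier_mat N N"
  by (simp add: poly_eval_mat_def)

text \<open>Convolution of coefficients along concatenation of words, the product of the free *-algebra.\<close>

definition poly_times :: "'i star_poly \<Rightarrow> 'i star_poly \<Rightarrow> 'i star_poly" where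
  "poly_times P Q = (\<Sum>v\<in>Poly_Mapping.keys P. \<Sum>w\<in>Poly_Mapping.keys Q.
     Poly_Mapping.single (v @ w) (Poly_Mapping.lookup P v * Poly_Mapping.lookup Q w))"

fun adj_letter :: "'i letter \<Rightarrow> 'i letter" where
  "adj_letter (Var i) = Adj i"
| "adj_letter (Adj i) = Var i"

definition adj_word :: "'i letter list \<Rightarrow> 'i letter list" where
  "adj_word w = rev (map adj_letter w)"

definition poly_star :: "'i star_poly \<Rightarrow> 'i star_poly" where
  "poly_star P = (\<Sum>w\<in>Poly_Mapping.keys P.
     Poly_Mapping.single (adj_word w) (cnj (Poly_Mapping.lookup P w)))"

primrec poly_of_exp :: "'i nc_exp \<Rightarrow> 'i star_poly" where
  "poly_of_exp (NVar i) = Poly_Mapping.single [Var i] 1"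
| "poly_of_exp NOne = Poly_Mapping.single [] 1"
| "poly_of_exp (NPlus e f) = poly_of_exp e + poly_of_exp f"
| "poly_of_exp (NTimes e f) = poly_times (poly_of_exp e) (poly_of_exp f)"
| "poly_of_exp (NScale c e) = poly_times (Poly_Mapping.single [] c) (poly_of_exp e)"
| "poly_of_exp (NStar e) = poly_star (poly_of_exp e)"

lemma letter_index_adj_letter [simp]: "letter_index (adj_letter l) = letter_index l"
  by (cases l) auto

lemma star_polys_zero: "0 \<in> star_polys K"
  by (simp add: star_polys_def)

lemma star_polys_single: "letter_index ` set w \<subseteq> K \<Longrightarrow> Poly_Mapping.single w c \<in> star_polys K"
  by (simp add: star_polys_def)

lemma star_polys_add: "P \<in> star_polys K \<Longrightarrow> Q \<in> star_polys K \<Longrightarrow> P + Q \<in> star_polys K"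
  using keys_add[of P Q] by (fastforce simp: star_polys_def)

lemma star_polys_sum: "(\<And>i. i \<in> S \<Longrightarrow> P i \<in> star_polys K) \<Longrightarrow> (\<Sum>i\<in>S. P i) \<in> star_polys K"
  by (induction S rule: infinite_finite_induct) (simp_all add: star_polys_zero star_polys_add)

lemma star_polysD:
  "P \<in> star_polys K \<Longrightarrow> w \<in> Poly_Mapping.keys P \<Longrightarrow> letter_index ` set w \<subseteq> K"
  by (simp add: star_polys_def)

lemma poly_times_star_polys:
  "P \<in> star_polys K \<Longrightarrow> Q \<in> star_polys K \<Longrightarrow> poly_times P Q \<in> star_polys K"
  unfolding poly_times_def
  by (intro star_polys_sum star_polys_single) (use star_polysD in fastforce)

lemma poly_star_star_polys: "P \<in> star_polys K \<Longrightarrow> poly_star P \<in> star_polys K"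
  unfolding poly_star_def
  by (intro star_polys_sum star_polys_single) (use star_polysD in \<open>fastforce simp: adj_word_def\<close>)

lemma poly_of_exp_star_polys: "vars e \<subseteq> K \<Longrightarrow> poly_of_exp e \<in> star_polys K"
  by (induction e)
    (auto intro!: star_polys_single star_polys_add poly_times_star_polys poly_star_star_polys)

lemma word_eval_adj_word: "word_eval x (adj_word w) = star (word_eval x w)"
proof (induction w)
  case (Cons l w)
  have "letter_eval x (adj_letter l) = star (letter_eval x l)"
    by (cases l) (simp_all add: star_star)
  then show ?case using Cons by (simp add: adj_word_def star_mult)
qed (simp add: adj_word_def)

lemma poly_eval_times: "poly_eval x (poly_times P Q) = poly_eval x P * poly_eval x Q"
  by (simp add: poly_eval_lincomb poly_times_def)
    (simp add: lincomb_def sum_product mult_scaleC_left mult_scaleC_right scaleC_scaleC mult.commute)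

lemma poly_eval_star: "poly_eval x (poly_star P) = star (poly_eval x P)"
  by (simp add: poly_eval_lincomb poly_star_def)
    (simp add: lincomb_def star_sum star_scaleC word_eval_adj_word)

lemma poly_eval_poly_of_exp: "poly_eval x (poly_of_exp e) = eval_exp x e"
  by (induction e) (simp_all add: poly_eval_times poly_eval_star, simp_all add: poly_eval_lincomb mult_scaleC_left)

lemma word_eval_mat_simps:
  "word_eval_mat N A [] = 1\<^sub>m N"
  "word_eval_mat N A (l # w) = letter_eval_mat A l * word_eval_mat N A w"
  by (simp_all add: word_eval_mat_def)

lemma letter_eval_mat_carrier:
  "A (letter_index l) \<in> carrier_mat N N \<Longrightarrow> letter_eval_mat A l \<in> carrier_mat N N"
  by (cases l) simp_all

lemma word_eval_mat_carrier:
  "\<forall>i\<in>letter_index ` set w. A i \<in> carrier_mat N N \<Longrightarrow> word_eval_mat N A w \<in> carrier_mat N N"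
proof (induction w)
  case (Cons l w)
  then have "letter_eval_mat A l \<in> carrier_mat N N" "word_eval_mat N A w \<in> carrier_mat N N"
    by (simp_all add: letter_eval_mat_carrier)
  then show ?case by (simp add: word_eval_mat_simps)
qed (simp add: word_eval_mat_simps)

lemma word_eval_mat_append:
  assumes "\<forall>i\<in>letter_index ` set (v @ w). A i \<in> carrier_mat N N"
  shows "word_eval_mat N A (v @ w) = word_eval_mat N A v * word_eval_mat N A w"
  using assms
proof (induction v)
  case Nil
  then show ?case using word_eval_mat_carrier[of w A N] by (simp add: word_eval_mat_simps)
next
  case (Cons l v)
  have "letter_eval_mat A l * word_eval_mat N A v * word_eval_mat N A w
      = letter_eval_mat A l * (word_eval_mat N A v * word_eval_mat N A w)"
    using Cons.prems
    by (intro assoc_mult_mat[of _ N N _ N _ N] letter_eval_mat_carrier word_eval_mat_carrier) auto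
  then show ?case using Cons by (simp add: word_eval_mat_simps)
qed

lemma word_eval_mat_adj_word:
  assumes "\<forall>i\<in>letter_index ` set w. A i \<in> carrier_mat N N"
  shows "word_eval_mat N A (adj_word w) = mat_adjoint (word_eval_mat N A w)"
  using assms
proof (induction w)
  case Nil
  then show ?case by (simp add: adj_word_def word_eval_mat_simps)
next
  case (Cons l w)
  have l: "letter_eval_mat A (adj_letter l) = mat_adjoint (letter_eval_mat A l)"
    by (cases l) simp_all
  have car: "letter_eval_mat A l \<in> carrier_mat N N" "word_eval_mat N A w \<in> carrier_mat N N"
    using Cons.prems by (auto intro!: letter_eval_mat_carrier word_eval_mat_carrier)
  have "word_eval_mat N A (adj_word (l # w)) = word_eval_mat N A (adj_word w @ [adj_letter l])"
    by (simp add: adj_word_def)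
  also have "\<dots> = word_eval_mat N A (adj_word w) * word_eval_mat N A [adj_letter l]"
    by (rule word_eval_mat_append) (use Cons.prems in \<open>auto simp: adj_word_def\<close>)
  also have "\<dots> = mat_adjoint (word_eval_mat N A w) * mat_adjoint (letter_eval_mat A l)"
    using Cons l car by (simp add: word_eval_mat_simps)
  also have "\<dots> = mat_adjoint (letter_eval_mat A l * word_eval_mat N A w)"
    using car by (simp add: mat_adjoint_mult)
  finally show ?case by (simp add: word_eval_mat_simps)
qed

lemma index_poly_eval_mat:
  "r < N \<Longrightarrow> s < N \<Longrightarrow>
    poly_eval_mat N A P $$ (r, s) = lincomb (\<lambda>w. word_eval_mat N A w $$ (r, s)) P"
  by (simp add: poly_eval_mat_lincomb)

lemma dim_poly_eval_mat [simp]: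
  "dim_row (poly_eval_mat N A P) = N" "dim_col (poly_eval_mat N A P) = N"
  by (simp_all add: poly_eval_mat_def)

lemma poly_eval_mat_add: "poly_eval_mat N A (P + Q) = poly_eval_mat N A P + poly_eval_mat N A Q"
  by (rule eq_matI) (simp_all add: index_poly_eval_mat)

lemma poly_eval_mat_single:
  assumes "\<forall>i\<in>letter_index ` set w. A i \<in> carrier_mat N N"
  shows "poly_eval_mat N A (Poly_Mapping.single w c) = c \<cdot>\<^sub>m word_eval_mat N A w"
  using word_eval_mat_carrier[OF assms]
  by (intro eq_matI) (simp_all add: index_poly_eval_mat scaleC_complex_def)

text \<open>The hypotheses only constrain the variables in \<open>K\<close>, since a microstate is undefined outside its
index set.\<close>

lemma poly_eval_mat_times:
  assumes A: "\<And>i. i \<in> K \<Longrightarrow> A i \<in> carrier_mat N N"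
    and P: "P \<in> star_polys K" and Q: "Q \<in> star_polys K"
  shows "poly_eval_mat N A (poly_times P Q) = poly_eval_mat N A P * poly_eval_mat N A Q"
proof (rule eq_matI)
  fix r s assume "r < dim_row (poly_eval_mat N A P * poly_eval_mat N A Q)"
    and "s < dim_col (poly_eval_mat N A P * poly_eval_mat N A Q)"
  then have rs: "r < N" "s < N" by simp_all
  let ?W = "word_eval_mat N A"
  have car: "?W w \<in> carrier_mat N N" if "w \<in> Poly_Mapping.keys P \<union> Poly_Mapping.keys Q" for w
    by (rule word_eval_mat_carrier) (use that A star_polysD[OF P] star_polysD[OF Q] in blast)
  have W: "?W (v @ w) $$ (r, s) = (\<Sum>l<N. ?W v $$ (r, l) * ?W w $$ (l, s))"
    if "v \<in> Poly_Mapping.keys P" "w \<in> Poly_Mapping.keys Q" for v w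
  proof -
    have "?W (v @ w) = ?W v * ?W w"
      by (rule word_eval_mat_append) (use that A star_polysD[OF P that(1)] star_polysD[OF Q that(2)] in auto)
    then show ?thesis
      using index_mult_mat_sum[of "?W v" N N "?W w" N r s] car that rs by simp
  qed
  have "poly_eval_mat N A (poly_times P Q) $$ (r, s) =
      (\<Sum>v\<in>Poly_Mapping.keys P. \<Sum>w\<in>Poly_Mapping.keys Q.
        Poly_Mapping.lookup P v * Poly_Mapping.lookup Q w * ?W (v @ w) $$ (r, s))"
    using rs by (simp add: index_poly_eval_mat poly_times_def scaleC_complex_def)
  also have "\<dots> = (\<Sum>v\<in>Poly_Mapping.keys P. \<Sum>w\<in>Poly_Mapping.keys Q. \<Sum>l<N.
        (Poly_Mapping.lookup P v * ?W v $$ (r, l)) * (Poly_Mapping.lookup Q w * ?W w $$ (l, s)))"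
    by (intro sum.cong refl) (simp add: W sum_distrib_left mult_ac)
  also have "\<dots> = (\<Sum>l<N. \<Sum>v\<in>Poly_Mapping.keys P. \<Sum>w\<in>Poly_Mapping.keys Q.
        (Poly_Mapping.lookup P v * ?W v $$ (r, l)) * (Poly_Mapping.lookup Q w * ?W w $$ (l, s)))"
    by (simp only: sum.swap[where B = "{..<N}"])
  also have "\<dots> = (\<Sum>l<N. poly_eval_mat N A P $$ (r, l) * poly_eval_mat N A Q $$ (l, s))"
    using rs by (intro sum.cong refl)
      (simp add: index_poly_eval_mat lincomb_def scaleC_complex_def sum_product)
  also have "\<dots> = (poly_eval_mat N A P * poly_eval_mat N A Q) $$ (r, s)"
    by (rule index_mult_mat_sum[symmetric]) (use rs in simp_all)
  finally show "poly_eval_mat N A (poly_times P Q) $$ (r, s) =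
      (poly_eval_mat N A P * poly_eval_mat N A Q) $$ (r, s)" .
qed simp_all

lemma poly_eval_mat_star:
  assumes A: "\<And>i. i \<in> K \<Longrightarrow> A i \<in> carrier_mat N N" and P: "P \<in> star_polys K"
  shows "poly_eval_mat N A (poly_star P) = mat_adjoint (poly_eval_mat N A P)"
proof (rule eq_matI)
  fix r s assume "r < dim_row (mat_adjoint (poly_eval_mat N A P))"
    and "s < dim_col (mat_adjoint (poly_eval_mat N A P))"
  then have rs: "r < N" "s < N" by simp_all
  have W: "word_eval_mat N A (adj_word w) $$ (r, s) = cnj (word_eval_mat N A w $$ (s, r))"
    if "w \<in> Poly_Mapping.keys P" for w
  proof -
    have K: "\<forall>i\<in>letter_index ` set w. A i \<in> carrier_mat N N"
      using that A star_polysD[OF P] by blast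
    show ?thesis
      using word_eval_mat_adj_word[OF K] word_eval_mat_carrier[OF K] rs by simp
  qed
  then show "poly_eval_mat N A (poly_star P) $$ (r, s) = mat_adjoint (poly_eval_mat N A P) $$ (r, s)"
    using rs by (simp add: index_poly_eval_mat poly_star_def)
      (simp add: lincomb_def scaleC_complex_def)
qed simp_all

lemma one_smult_mat: "(1 :: complex) \<cdot>\<^sub>m A = A"
  by (rule eq_matI) simp_all

lemma poly_eval_mat_poly_of_exp:
  assumes "\<And>i. i \<in> vars e \<Longrightarrow> A i \<in> carrier_mat N N"
  shows "poly_eval_mat N A (poly_of_exp e) = eval_exp_mat N A e"
  using assms
proof (induction e)
  case (NVar i)
  then have "poly_eval_mat N A (Poly_Mapping.single [Var i] 1) = 1 \<cdot>\<^sub>m (A i * 1\<^sub>m N)"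
    by (subst poly_eval_mat_single) (simp_all add: word_eval_mat_simps)
  then show ?case using NVar by (simp add: one_smult_mat)
next
  case NOne
  have "poly_eval_mat N A (Poly_Mapping.single [] 1) = 1 \<cdot>\<^sub>m 1\<^sub>m N"
    by (subst poly_eval_mat_single) (simp_all add: word_eval_mat_simps)
  then show ?case by (simp add: one_smult_mat)
next
  case (NPlus e f)
  then show ?case by (simp add: poly_eval_mat_add)
next
  case (NTimes e f)
  have "poly_eval_mat N A (poly_times (poly_of_exp e) (poly_of_exp f))
      = poly_eval_mat N A (poly_of_exp e) * poly_eval_mat N A (poly_of_exp f)"
    by (rule poly_eval_mat_times[where K = "vars e \<union> vars f"])
      (use NTimes.prems in \<open>auto intro: poly_of_exp_star_polys\<close>)
  then show ?case using NTimes by simp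
next
  case (NScale c e)
  have "poly_eval_mat N A (poly_times (Poly_Mapping.single [] c) (poly_of_exp e))
      = poly_eval_mat N A (Poly_Mapping.single [] c) * poly_eval_mat N A (poly_of_exp e)"
    by (rule poly_eval_mat_times[where K = "vars e"])
      (use NScale.prems in \<open>auto intro: poly_of_exp_star_polys star_polys_single\<close>)
  also have "poly_eval_mat N A (Poly_Mapping.single [] c) = c \<cdot>\<^sub>m 1\<^sub>m N"
    by (subst poly_eval_mat_single) (simp_all add: word_eval_mat_simps)
  also have "c \<cdot>\<^sub>m 1\<^sub>m N * poly_eval_mat N A (poly_of_exp e) = c \<cdot>\<^sub>m eval_exp_mat N A e"
    using NScale eval_exp_mat_carrier[of e A N]
    by (simp add: mult_smult_assoc_mat[of _ N N _ N])
  finally show ?case by simp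
next
  case (NStar e)
  have "poly_eval_mat N A (poly_star (poly_of_exp e)) = mat_adjoint (poly_eval_mat N A (poly_of_exp e))"
    by (rule poly_eval_mat_star[where K = "vars e"])
      (use NStar.prems in \<open>auto intro: poly_of_exp_star_polys\<close>)
  then show ?case using NStar by simp
qed

primrec exp_of_letter :: "'i letter \<Rightarrow> 'i nc_exp" where
  "exp_of_letter (Var i) = NVar i"
| "exp_of_letter (Adj i) = NStar (NVar i)"

primrec exp_of_word :: "'i letter list \<Rightarrow> 'i nc_exp" where
  "exp_of_word [] = NOne"
| "exp_of_word (l # w) = NTimes (exp_of_letter l) (exp_of_word w)"

lemma vars_exp_of_word: "vars (exp_of_word w) = letter_index ` set w"
proof (induction w)
  case (Cons l w)
  then show ?case by (cases l) auto
qed simp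

lemma eval_exp_of_word: "eval_exp x (exp_of_word w) = word_eval x w"
proof (induction w)
  case (Cons l w)
  then show ?case by (cases l) auto
qed simp

lemma eval_exp_mat_of_word: "eval_exp_mat N A (exp_of_word w) = word_eval_mat N A w"
proof (induction w)
  case (Cons l w)
  then show ?case by (cases l) (auto simp: word_eval_mat_simps)
qed (simp add: word_eval_mat_simps)

abbreviation NZero :: "'i nc_exp" where "NZero \<equiv> NScale 0 NOne"

text \<open>A *-polynomial is the sum of its monomials.\<close>

lemma star_poly_induct [consumes 1, case_names zero single add]:
  assumes "P \<in> star_polys K"
    and "\<Phi> 0"
    and "\<And>w c. letter_index ` set w \<subseteq> K \<Longrightarrow> \<Phi> (Poly_Mapping.single w c)"
    and "\<And>P Q. \<Phi> P \<Longrightarrow> \<Phi> Q \<Longrightarrow> \<Phi> (P + Q)"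
  shows "\<Phi> P"
proof -
  have "\<Phi> (\<Sum>w\<in>S. Poly_Mapping.single w (Poly_Mapping.lookup P w))"
    if "finite S" "S \<subseteq> Poly_Mapping.keys P" for S
    using that
  proof (induction S rule: finite_induct)
    case (insert w S)
    then show ?case using assms star_polysD[OF assms(1), of w] by simp
  qed (use assms in simp)
  moreover have "(\<Sum>w\<in>Poly_Mapping.keys P. Poly_Mapping.single w (Poly_Mapping.lookup P w)) = P"
    by (rule poly_mapping_eqI)
      (simp add: lookup_sum lookup_single when_def in_keys_iff sum.delta')
  ultimately show ?thesis by (metis finite_keys order.refl)
qed

text \<open>The same expression computes the values in the algebra and in matrices of every size; this is what
links the defining condition of microstates to the size-free Lipschitz bounds.\<close>

lemma exp_of_star_poly:
  assumes "P \<in> star_polys K"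
  obtains e where "vars e \<subseteq> K" "\<And>x::'i \<Rightarrow> 'a::cstar_algebra. poly_eval x P = eval_exp x e"
    "\<And>N A. (\<And>i. i \<in> K \<Longrightarrow> A i \<in> carrier_mat N N) \<Longrightarrow> poly_eval_mat N A P = eval_exp_mat N A e"
proof -
  define \<Phi> where "\<Phi> P \<longleftrightarrow> (\<exists>e. vars e \<subseteq> K \<and> (\<forall>x::'i \<Rightarrow> 'a. poly_eval x P = eval_exp x e) \<and>
    (\<forall>N A. (\<forall>i\<in>K. A i \<in> carrier_mat N N) \<longrightarrow> poly_eval_mat N A P = eval_exp_mat N A e))" for P
  from assms have "\<Phi> P"
  proof (induction rule: star_poly_induct)
    case zero
    have "poly_eval_mat N A 0 = 0 \<cdot>\<^sub>m 1\<^sub>m N" for N and A :: "'i \<Rightarrow> complex mat"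
      by (rule eq_matI) (simp_all add: index_poly_eval_mat)
    then show ?case
      unfolding \<Phi>_def by (intro exI[of _ NZero]) (simp add: poly_eval_lincomb)
  next
    case (single w c)
    then show ?case
      unfolding \<Phi>_def
      by (intro exI[of _ "NScale c (exp_of_word w)"])
        (auto simp: vars_exp_of_word poly_eval_lincomb eval_exp_of_word eval_exp_mat_of_word
          intro!: poly_eval_mat_single)
  next
    case (add P Q)
    then obtain e f where "vars e \<subseteq> K" "vars f \<subseteq> K"
      "\<forall>x::'i \<Rightarrow> 'a. poly_eval x P = eval_exp x e" "\<forall>x::'i \<Rightarrow> 'a. poly_eval x Q = eval_exp x f"
      "\<forall>N A. (\<forall>i\<in>K. A i \<in> carrier_mat N N) \<longrightarrow> poly_eval_mat N A P = eval_exp_mat N A e"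
      "\<forall>N A. (\<forall>i\<in>K. A i \<in> carrier_mat N N) \<longrightarrow> poly_eval_mat N A Q = eval_exp_mat N A f"
      unfolding \<Phi>_def by blast
    then show ?case
      unfolding \<Phi>_def
      by (intro exI[of _ "NPlus e f"]) (simp add: poly_eval_mat_add poly_eval_lincomb)
  qed
  then show thesis using that unfolding \<Phi>_def by blast
qed

section \<open>Approximation in the generated algebra\<close>

text \<open>The values of expressions in \<open>x\<close> form a unital *-subalgebra, which therefore contains the one
generated by \<open>x\<close>.\<close>

lemma cstar_generated_approx:
  fixes x :: "'i \<Rightarrow> 'a::cstar_algebra"
  assumes "z \<in> cstar_generated (x ` K)" "0 < \<epsilon>"
  obtains e where "vars e \<subseteq> K" "norm (eval_exp x e - z) < \<epsilon>"
proof -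
  define E where "E = eval_exp x ` {e. vars e \<subseteq> K}"
  have E: "eval_exp x e \<in> E" if "vars e \<subseteq> K" for e
    using that by (simp add: E_def)
  have "unital_star_subalgebra E"
    unfolding unital_star_subalgebra_def
  proof (intro conjI ballI allI)
    show "1 \<in> E" using E[of NOne] by simp
    fix u v assume "u \<in> E" "v \<in> E"
    then obtain e f where ef: "vars e \<subseteq> K" "vars f \<subseteq> K" "u = eval_exp x e" "v = eval_exp x f"
      by (auto simp: E_def)
    show "u + v \<in> E" using E[of "NPlus e f"] ef by simp
    show "u * v \<in> E" using E[of "NTimes e f"] ef by simp
    show "star u \<in> E" using E[of "NStar e"] ef by simp
    show "c *\<^sub>C u \<in> E" for c using E[of "NScale c e"] ef by simp
  qed
  moreover have "x ` K \<subseteq> E"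
  proof
    fix u assume "u \<in> x ` K"
    then obtain i where "i \<in> K" "u = x i" by blast
    then show "u \<in> E" using E[of "NVar i"] by simp
  qed
  ultimately have "unital_star_subalgebra hull (x ` K) \<subseteq> E"
    by (intro hull_minimal)
  then have "z \<in> closure E"
    using assms(1) closure_mono unfolding cstar_generated_def by blast
  then obtain u where "u \<in> E" "dist u z < \<epsilon>"
    using assms(2) by (meson closure_approachable)
  then show thesis using that by (auto simp: E_def dist_norm)
qed

text \<open>A plain approximation may exceed the norm bound \<open>R\<close> of its target by a small amount. Multiplying it by
\<open>R / (R + \<eta> / 2)\<close> repairs this at the cost of another \<open>\<eta> / 2\<close>. The strict inequality leaves room
for the error \<open>\<delta>'\<close> in the norm of a microstate, so that the cutoff can be met exactly.\<close>

lemma cstar_generated_approx_bounded: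
  fixes x :: "'i \<Rightarrow> 'a::cstar_algebra"
  assumes z: "z \<in> cstar_generated (x ` K)" "norm z \<le> R" and R: "0 < R" and \<eta>: "0 < \<eta>"
  obtains e where "vars e \<subseteq> K" "norm (eval_exp x e) < R" "norm (eval_exp x e - z) < \<eta>"
proof -
  obtain g where g: "vars g \<subseteq> K" "norm (eval_exp x g - z) < \<eta> / 2"
    using cstar_generated_approx[OF z(1), of "\<eta> / 2"] \<eta> by auto
  \<comment> \<open>\<open>t \<parallel>g\<parallel> < R\<close> because \<open>\<parallel>g\<parallel> < R + \<eta> / 2\<close>, and \<open>(1 - t) R \<le> \<eta> / 2\<close>.\<close>
  define t where "t = R / (R + \<eta> / 2)"
  have t: "0 < t" "t \<le> 1" "t * (R + \<eta> / 2) = R" "(1 - t) * R \<le> \<eta> / 2"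
    using R \<eta> by (auto simp: t_def field_simps)
  let ?g = "eval_exp x g"
  have ev: "eval_exp x (NScale (complex_of_real t) g) = t *\<^sub>R ?g"
    by (simp add: scaleR_scaleC)
  have "norm ?g < R + \<eta> / 2"
    using norm_triangle_sub[of ?g z] g(2) z(2) by simp
  then have "norm (t *\<^sub>R ?g) < R"
    using t by (metis abs_of_pos mult_less_cancel_left_pos norm_scaleR)
  moreover have "norm (t *\<^sub>R ?g - z) < \<eta>"
  proof -
    have "t *\<^sub>R ?g - z = t *\<^sub>R (?g - z) - (1 - t) *\<^sub>R z" by (simp add: algebra_simps)
    also have "norm \<dots> \<le> t * norm (?g - z) + (1 - t) * norm z"
      using t norm_triangle_ineq4[of "t *\<^sub>R (?g - z)" "(1 - t) *\<^sub>R z"] by simp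
    also have "\<dots> < \<eta> / 2 + \<eta> / 2"
    proof (rule add_less_le_mono)
      show "t * norm (?g - z) < \<eta> / 2"
        using t g(2) mult_left_le_one_le[of "norm (?g - z)" t] by simp
      show "(1 - t) * norm z \<le> \<eta> / 2"
        using t z(2) mult_left_mono[of "norm z" R "1 - t"] by simp
    qed
    finally show ?thesis by simp
  qed
  ultimately show thesis using that[of "NScale (complex_of_real t) g"] g(1) ev by simp
qed

section \<open>Comparison of orbital covering numbers\<close>

text \<open>Choosing one \<open>D\<close> for every ball of a cover of \<open>\<Omega>'\<close> that meets the image of \<open>\<Phi>\<close> yields a cover of
\<open>\<Omega>\<close>, provided that two elements sent near the same orbit lie near each other up to conjugation. The
representatives lie in \<open>\<Omega>\<close>, as the definition of a cover demands.\<close>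

lemma orb_covering_number_le_of_map:
  assumes map: "\<And>D. D \<in> \<Omega> \<Longrightarrow> \<Phi> D \<in> \<Omega>'"
    and sep: "\<And>D E B U V. D \<in> \<Omega> \<Longrightarrow> E \<in> \<Omega> \<Longrightarrow> B \<in> \<Omega>' \<Longrightarrow>
      U \<in> unitary_mats N \<Longrightarrow> V \<in> unitary_mats N \<Longrightarrow>
      \<forall>j\<in>F'. op_norm (\<Phi> D j - conj_mat U (B j)) < \<epsilon>' \<Longrightarrow>
      \<forall>j\<in>F'. op_norm (\<Phi> E j - conj_mat V (B j)) < \<epsilon>' \<Longrightarrow>
      \<exists>W\<in>unitary_mats N. \<forall>i\<in>F. op_norm (D i - conj_mat W (E i)) < \<epsilon>"
  shows "orb_covering_number N F \<epsilon> \<Omega> \<le> orb_covering_number N F' \<epsilon>' \<Omega>'"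
  unfolding orb_covering_number_def[of N F' \<epsilon>' \<Omega>']
proof (rule INF_greatest, clarify)
  fix \<Omega>\<^sub>0 assume fin: "finite \<Omega>\<^sub>0" and cov: "orb_cover N F' \<epsilon>' \<Omega>' \<Omega>\<^sub>0"
  define near where "near B D \<longleftrightarrow> D \<in> \<Omega> \<and>
    (\<exists>U\<in>unitary_mats N. \<forall>j\<in>F'. op_norm (\<Phi> D j - conj_mat U (B j)) < \<epsilon>')" for B D
  define \<Omega>\<^sub>1 where "\<Omega>\<^sub>1 = (\<lambda>B. SOME D. near B D) ` {B \<in> \<Omega>\<^sub>0. \<exists>D. near B D}"
  have near_rep: "near B (SOME D. near B D)" if "near B D" for B D
      by (rule someI[of "near B", OF that])
  have "orb_cover N F \<epsilon> \<Omega> \<Omega>\<^sub>1"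
    unfolding orb_cover_def
  proof (intro conjI ballI)
    show "\<Omega>\<^sub>1 \<subseteq> \<Omega>"
    proof
      fix E assume "E \<in> \<Omega>\<^sub>1"
      then obtain B D where "near B D" "E = (SOME D. near B D)" by (auto simp: \<Omega>\<^sub>1_def)
      then have "near B E" using near_rep by simp
      then show "E \<in> \<Omega>" by (simp add: near_def)
    qed
    next
    fix D assume D: "D \<in> \<Omega>"
    obtain B where B: "B \<in> \<Omega>\<^sub>0" "near B D"
      using cov map[OF D] D unfolding orb_cover_def near_def by blast
    define E where "E = (SOME D. near B D)"
    have E: "near B E" unfolding E_def by (rule near_rep[OF B(2)])
    have "E \<in> \<Omega>\<^sub>1" using B by (auto simp: \<Omega>\<^sub>1_def E_def)
    moreover have "\<exists>W\<in>unitary_mats N. \<forall>i\<in>F. op_norm (D i - conj_mat W (E i)) < \<epsilon>"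
    proof -
      have B': "B \<in> \<Omega>'" using B(1) cov by (auto simp: orb_cover_def)
      obtain U where U: "U \<in> unitary_mats N" "\<forall>j\<in>F'. op_norm (\<Phi> D j - conj_mat U (B j)) < \<epsilon>'"
        using B(2) unfolding near_def by (elim conjE bexE)
      obtain V where V: "V \<in> unitary_mats N" "\<forall>j\<in>F'. op_norm (\<Phi> E j - conj_mat V (B j)) < \<epsilon>'"
        and E': "E \<in> \<Omega>"
        using E unfolding near_def by (elim conjE bexE)
      show ?thesis by (rule sep[OF D E' B' U(1) V(1) U(2) V(2)])
    qed
    ultimately show "\<exists>E\<in>\<Omega>\<^sub>1. \<exists>W\<in>unitary_mats N. \<forall>i\<in>F. op_norm (D i - conj_mat W (E i)) < \<epsilon>"
      by (intro bexI[of _ E])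
  qed
  moreover have "finite \<Omega>\<^sub>1" using fin by (simp add: \<Omega>\<^sub>1_def)
  moreover have "card \<Omega>\<^sub>1 \<le> card \<Omega>\<^sub>0"
  proof -
    have "card \<Omega>\<^sub>1 \<le> card {B \<in> \<Omega>\<^sub>0. \<exists>D. near B D}"
      unfolding \<Omega>\<^sub>1_def using fin by (intro card_image_le) simp
    also have "\<dots> \<le> card \<Omega>\<^sub>0" using fin by (intro card_mono) auto
    finally show ?thesis .
  qed
  ultimately show "orb_covering_number N F \<epsilon> \<Omega> \<le> enat (card \<Omega>\<^sub>0)"
    unfolding orb_covering_number_def by (intro INF_lower2[of \<Omega>\<^sub>1]) auto
qed

lemma mult_divide_add_one:
  fixes a b :: real
  assumes "0 \<le> a"
  shows "(a + 1) * (b / (a + 1)) = b"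
proof -
  have "a + 1 \<noteq> 0" using assms by linarith
  then show ?thesis by (simp only: times_divide_eq_right nonzero_mult_div_cancel_left not_False_eq_True)
qed

text \<open>The quantifiers follow the definition of the entropy. The pair \<open>(F', \<epsilon>')\<close> answers \<open>(F, \<epsilon>)\<close> alone,
through the expressions \<open>g\<^sub>i\<close> that recover \<open>y\<^sub>i\<close> from \<open>x\<close>; the pair \<open>(\<delta>', Q')\<close> may depend on
\<open>(\<delta>, Q)\<close> as well, through the expressions \<open>f\<^sub>j\<close> that recover \<open>x\<^sub>j\<close> from \<open>y\<close>; neither depends on the
matrix size \<open>N\<close>. The subset \<open>K\<^sub>0\<close> is where the smaller algebra enters: it confines \<open>F'\<close>.\<close>

lemma orb_covering_number_microstates_transfer:
  fixes x :: "'k \<Rightarrow> 'a::cstar_algebra" and y :: "'l \<Rightarrow> 'a"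
  assumes R: "0 < R" "\<And>j. j \<in> K \<Longrightarrow> norm (x j) \<le> R"
    and x: "x ` K \<subseteq> cstar_generated (y ` L)"
    and F: "finite F" "F \<subseteq> L" and K\<^sub>0: "K\<^sub>0 \<subseteq> K"
    and y: "y ` F \<subseteq> cstar_generated (x ` K\<^sub>0)" and \<epsilon>: "0 < \<epsilon>"
  obtains F' \<epsilon>' where "finite F'" "F' \<subseteq> K\<^sub>0" "0 < \<epsilon>'"
    "\<And>\<delta> Q. 0 < \<delta> \<Longrightarrow> finite Q \<Longrightarrow> Q \<subseteq> star_polys K \<Longrightarrow>
      \<exists>\<delta>' Q'. 0 < \<delta>' \<and> finite Q' \<and> Q' \<subseteq> star_polys L \<and>
        (\<forall>N. orb_covering_number N F \<epsilon> (microstates S N L y Q' \<delta>')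
          \<le> orb_covering_number N F' \<epsilon>' (microstates R N K x Q \<delta>))"
proof -
  have "\<forall>i\<in>F. \<exists>e. vars e \<subseteq> K\<^sub>0 \<and> norm (eval_exp x e - y i) < \<epsilon> / 8"
  proof
    fix i assume "i \<in> F"
    then have "y i \<in> cstar_generated (x ` K\<^sub>0)" using y by auto
    then obtain e where "vars e \<subseteq> K\<^sub>0" "norm (eval_exp x e - y i) < \<epsilon> / 8"
      by (rule cstar_generated_approx[where \<epsilon> = "\<epsilon> / 8"]) (use \<epsilon> in simp)
    then show "\<exists>e. vars e \<subseteq> K\<^sub>0 \<and> norm (eval_exp x e - y i) < \<epsilon> / 8" by blast
  qed
  from bchoice[OF this] obtain g where
    g: "\<And>i. i \<in> F \<Longrightarrow> vars (g i) \<subseteq> K\<^sub>0" "\<And>i. i \<in> F \<Longrightarrow> norm (eval_exp x (g i) - y i) < \<epsilon> / 8"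
    by blast
  define F' where "F' = (\<Union>i\<in>F. vars (g i))"
  define \<Lambda> where "\<Lambda> = (\<Sum>i\<in>F. exp_lip R (g i))"
  \<comment> \<open>The final bound \<open>\<epsilon> / 2\<close> per matrix is the sum of four errors of size \<open>\<epsilon> / 8\<close>: \<open>g\<^sub>i(x)\<close> against \<open>y\<^sub>i\<close>,
    \<open>g\<^sub>i(f(y))\<close> against \<open>g\<^sub>i(x)\<close>, the microstate tolerance \<open>\<delta>'\<close>, and the cover of radius \<open>\<epsilon>'\<close>. Adding
    \<open>1\<close> to \<open>\<Lambda>\<close> avoids a zero denominator.\<close>
  define \<epsilon>' where "\<epsilon>' = \<epsilon> / 8 / (\<Lambda> + 1)"
  have lip_nn: "0 \<le> exp_lip R e" for e :: "'k nc_exp"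
    using R(1) by (simp add: exp_lip_nonneg)
  have \<Lambda>: "0 \<le> \<Lambda>" unfolding \<Lambda>_def by (rule sum_nonneg) (rule lip_nn)
  have \<epsilon>': "0 < \<epsilon>'" using \<epsilon> \<Lambda> by (simp add: \<epsilon>'_def)
  have lip_g: "exp_lip R (g i) * \<epsilon>' \<le> \<epsilon> / 8" if "i \<in> F" for i
  proof -
    have "exp_lip R (g i) \<le> \<Lambda>"
      unfolding \<Lambda>_def by (rule member_le_sum) (use that F(1) lip_nn in auto)
    then have "exp_lip R (g i) * \<epsilon>' \<le> (\<Lambda> + 1) * \<epsilon>'" using \<epsilon>' by simp
    also have "\<dots> = \<epsilon> / 8"
      unfolding \<epsilon>'_def by (rule mult_divide_add_one[OF \<Lambda>])
    finally show ?thesis .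
  qed
  have F'K: "F' \<subseteq> K\<^sub>0" using g(1) by (auto simp: F'_def)
  have finF': "finite F'" using F(1) by (simp add: F'_def)
  show thesis
  proof (rule that[OF finF' F'K \<epsilon>'])
    fix \<delta> :: real and Q :: "'k star_poly set"
    assume \<delta>: "0 < \<delta>" and Q: "finite Q" "Q \<subseteq> star_polys K"
    have "\<forall>P\<in>Q. \<exists>e. vars e \<subseteq> K \<and> poly_eval x P = eval_exp x e \<and>
        (\<forall>N A. (\<forall>j\<in>K. A j \<in> carrier_mat N N) \<longrightarrow> poly_eval_mat N A P = eval_exp_mat N A e)"
    proof
      fix P assume "P \<in> Q"
      then have "P \<in> star_polys K" using Q by blast
      then show "\<exists>e. vars e \<subseteq> K \<and> poly_eval x P = eval_exp x e \<and>
        (\<forall>N A. (\<forall>j\<in>K. A j \<in> carrier_mat N N) \<longrightarrow> poly_eval_mat N A P = eval_exp_mat N A e)"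
        by (rule exp_of_star_poly) blast
    qed
    from bchoice[OF this] obtain p where
      p: "\<And>P. P \<in> Q \<Longrightarrow> vars (p P) \<subseteq> K" "\<And>P. P \<in> Q \<Longrightarrow> poly_eval x P = eval_exp x (p P)"
        "\<And>P N A. P \<in> Q \<Longrightarrow> \<forall>j\<in>K. A j \<in> carrier_mat N N \<Longrightarrow>
          poly_eval_mat N A P = eval_exp_mat N A (p P)"
      by blast
    define M where "M = (\<Sum>P\<in>Q. exp_lip R (p P))"
    have M: "0 \<le> M" unfolding M_def by (rule sum_nonneg) (rule lip_nn)
    \<comment> \<open>The bound by \<open>\<epsilon>'\<close> serves the expressions \<open>g\<^sub>i\<close>, the other one serves the polynomials in \<open>Q\<close>.\<close>
    define \<eta> where "\<eta> = min \<epsilon>' (\<delta> / 2 / (M + 1))"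
    have \<eta>: "0 < \<eta>" "\<eta> \<le> \<epsilon>'" "\<eta> \<le> \<delta> / 2 / (M + 1)"
      using \<epsilon>' \<delta> M by (auto simp: \<eta>_def)
    have lip_p: "exp_lip R (p P) * \<eta> \<le> \<delta> / 2" if "P \<in> Q" for P
    proof -
      have "exp_lip R (p P) \<le> M"
        unfolding M_def by (rule member_le_sum) (use that Q(1) lip_nn in auto)
      then have "exp_lip R (p P) * \<eta> \<le> (M + 1) * (\<delta> / 2 / (M + 1))"
        using \<eta> M by (intro mult_mono) auto
      also have "\<dots> = \<delta> / 2"
        by (rule mult_divide_add_one[OF M])
      finally show ?thesis .
    qed
    define V where "V = F' \<union> (\<Union>P\<in>Q. vars (p P))"
    have V: "finite V" "V \<subseteq> K" using finF' Q(1) p(1) F'K K\<^sub>0 by (auto simp: V_def)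
    have "\<forall>j\<in>V. \<exists>e. vars e \<subseteq> L \<and> norm (eval_exp y e) < R \<and> norm (eval_exp y e - x j) < \<eta>"
    proof
      fix j assume "j \<in> V"
      then have "x j \<in> cstar_generated (y ` L)" "norm (x j) \<le> R" using x V R(2) by auto
      then show "\<exists>e. vars e \<subseteq> L \<and> norm (eval_exp y e) < R \<and> norm (eval_exp y e - x j) < \<eta>"
        by (rule cstar_generated_approx_bounded[OF _ _ R(1) \<eta>(1)]) blast
    qed
    from bchoice[OF this] obtain f where
      f: "\<And>j. j \<in> V \<Longrightarrow> vars (f j) \<subseteq> L" "\<And>j. j \<in> V \<Longrightarrow> norm (eval_exp y (f j)) < R"
        "\<And>j. j \<in> V \<Longrightarrow> norm (eval_exp y (f j) - x j) < \<eta>"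
      by blast
    \<comment> \<open>Variables outside the finite set \<open>V\<close> are sent to zero, which satisfies the cutoff for free and keeps
      the set \<open>Q'\<close> of tested polynomials finite.\<close>
    define s where "s j = (if j \<in> V then f j else NZero)" for j
    have sL: "vars (s j) \<subseteq> L" for j using f(1) by (simp add: s_def)
    define \<delta>' where "\<delta>' = Min ({\<delta> / 2, \<epsilon> / 8} \<union> (\<lambda>j. R - norm (eval_exp y (f j))) ` V)"
    have \<delta>'_pos: "0 < \<delta>'" unfolding \<delta>'_def using V \<delta> \<epsilon> f(2) by (subst Min_gr_iff) auto
    have \<delta>': "\<delta>' \<le> \<delta> / 2" "\<delta>' \<le> \<epsilon> / 8" "\<And>j. j \<in> V \<Longrightarrow> norm (eval_exp y (f j)) + \<delta>' \<le> R"
    proof -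
      show "\<delta>' \<le> \<delta> / 2" "\<delta>' \<le> \<epsilon> / 8" unfolding \<delta>'_def by (rule Min_le; use V in simp)+
      fix j assume "j \<in> V"
      then have "\<delta>' \<le> R - norm (eval_exp y (f j))" unfolding \<delta>'_def by (intro Min_le) (use V in auto)
      then show "norm (eval_exp y (f j)) + \<delta>' \<le> R" by simp
    qed
    \<comment> \<open>\<open>g\<^sub>i \<circ> f - T\<^sub>i\<close>, which is small at \<open>y\<close>.\<close>
    define r where "r i = NPlus (subst_exp s (g i)) (NScale (-1) (NVar i))" for i
    \<comment> \<open>The three families control the cutoff of \<open>f(D)\<close>, the conditions from \<open>Q\<close>, and the distance between
      \<open>D\<^sub>i\<close> and \<open>g\<^sub>i(f(D))\<close>.\<close>
    define T where "T = f ` V \<union> (\<lambda>P. subst_exp s (p P)) ` Q \<union> r ` F"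
    have TL: "vars e \<subseteq> L" if "e \<in> T" for e
    proof -
      consider j where "j \<in> V" "e = f j" | P where "e = subst_exp s (p P)" | i where "i \<in> F" "e = r i"
        using \<open>e \<in> T\<close> by (auto simp: T_def)
      then show ?thesis
      proof cases
        case 1
        then show ?thesis using f(1) by simp
      next
        case 2
        then show ?thesis using sL by (simp add: vars_subst_exp UN_least)
      next
        case 3
        then show ?thesis using sL F(2) by (auto simp: r_def vars_subst_exp UN_least)
      qed
    qed
    define Q' where "Q' = poly_of_exp ` T"
    have Q': "finite Q'" "Q' \<subseteq> star_polys L"
      using V(1) Q(1) F(1) TL by (auto simp: Q'_def T_def intro!: poly_of_exp_star_polys)
    have approx: "norm (eval_exp y (subst_exp s e) - eval_exp x e) \<le> exp_lip R e * \<eta>"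
      if "vars e \<subseteq> V" for e
      unfolding eval_subst_exp
    proof (rule eval_exp_lipschitz)
      fix j assume "j \<in> vars e"
      then have j: "j \<in> V" using that by blast
      then show "norm (eval_exp y (s j)) \<le> R" "norm (eval_exp y (s j) - x j) \<le> \<eta>" "norm (x j) \<le> R"
        using f(2,3)[OF j] R(2) V(2) by (auto simp: s_def)
    qed (use R in simp)
    show "\<exists>\<delta>' Q'. 0 < \<delta>' \<and> finite Q' \<and> Q' \<subseteq> star_polys L \<and>
        (\<forall>N. orb_covering_number N F \<epsilon> (microstates S N L y Q' \<delta>')
          \<le> orb_covering_number N F' \<epsilon>' (microstates R N K x Q \<delta>))"
    proof (intro exI[of _ \<delta>'] exI[of _ Q'] conjI allI)
      show "0 < \<delta>'" "finite Q'" "Q' \<subseteq> star_polys L" by (fact \<delta>'_pos Q')+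
      fix N
      let ?\<Omega> = "microstates S N L y Q' \<delta>'" and ?\<Omega>' = "microstates R N K x Q \<delta>"
      define \<Phi> where "\<Phi> D = (\<lambda>j\<in>K. eval_exp_mat N D (s j))" for D :: "'l \<Rightarrow> complex mat"
      have car: "D i \<in> carrier_mat N N" if "D \<in> ?\<Omega>" "i \<in> L" for D i
        using that by (auto simp: microstates_def)
      have ecar: "eval_exp_mat N D e \<in> carrier_mat N N" if "D \<in> ?\<Omega>" "vars e \<subseteq> L" for D e
        using that car by (intro eval_exp_mat_carrier) auto
      have \<Phi>car: "\<Phi> D j \<in> carrier_mat N N" if "D \<in> ?\<Omega>" "j \<in> K" for D j
        using that ecar[OF _ sL] by (simp add: \<Phi>_def)
      have micro: "op_norm (eval_exp_mat N D e) \<le> norm (eval_exp y e) + \<delta>'" if "D \<in> ?\<Omega>" "e \<in> T" for D e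
      proof -
        have "op_norm (poly_eval_mat N D (poly_of_exp e)) \<le> norm (poly_eval y (poly_of_exp e)) + \<delta>'"
          using that by (auto simp: microstates_def Q'_def)
        moreover have "poly_eval_mat N D (poly_of_exp e) = eval_exp_mat N D e"
          using that car TL[OF that(2)] by (intro poly_eval_mat_poly_of_exp) auto
        ultimately show ?thesis by (simp add: poly_eval_poly_of_exp)
      qed
      have \<Phi>_eval: "eval_exp_mat N (\<Phi> D) e = eval_exp_mat N D (subst_exp s e)" if "vars e \<subseteq> K" for D e
        unfolding eval_subst_exp_mat by (rule eval_exp_mat_cong) (use that in \<open>auto simp: \<Phi>_def\<close>)
      have map: "\<Phi> D \<in> ?\<Omega>'" if D: "D \<in> ?\<Omega>" for D
        unfolding microstates_def
      proof (intro CollectI conjI ballI)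
        show "\<Phi> D \<in> K \<rightarrow>\<^sub>E carrier_mat N N"
          using ecar[OF D sL] by (auto simp: \<Phi>_def)
        show "op_norm (\<Phi> D j) \<le> R" if j: "j \<in> K" for j
        proof (cases "j \<in> V")
          case True
          then have "f j \<in> T" by (simp add: T_def)
          then show ?thesis
            using micro[OF D, of "f j"] \<delta>'(3)[OF True] True j by (simp add: \<Phi>_def s_def)
        next
          case False
          have "0 \<cdot>\<^sub>m 1\<^sub>m N = (0\<^sub>m N N :: complex mat)" by (rule eq_matI) simp_all
          then show ?thesis using False j R(1) by (simp add: \<Phi>_def s_def)
        qed
        fix P assume P: "P \<in> Q"
        have "poly_eval_mat N (\<Phi> D) P = eval_exp_mat N D (subst_exp s (p P))"
          using p(3)[OF P, of "\<Phi> D" N] \<Phi>car[OF D] \<Phi>_eval[OF p(1)[OF P]] by simp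
        moreover have "op_norm (eval_exp_mat N D (subst_exp s (p P)))
            \<le> norm (eval_exp y (subst_exp s (p P))) + \<delta>'"
          by (rule micro[OF D]) (use P in \<open>simp add: T_def\<close>)
        moreover have "norm (eval_exp y (subst_exp s (p P)) - eval_exp x (p P)) \<le> \<delta> / 2"
        proof -
          have "vars (p P) \<subseteq> V" using P by (auto simp: V_def)
          from order_trans[OF approx[OF this] lip_p[OF P]] show ?thesis .
        qed
        ultimately show "op_norm (poly_eval_mat N (\<Phi> D) P) \<le> norm (poly_eval x P) + \<delta>"
          using norm_triangle_sub[of "eval_exp y (subst_exp s (p P))" "eval_exp x (p P)"]
            p(2)[OF P] \<delta>'(1) by simp
      qed
      have close: "op_norm (D i - conj_mat U (eval_exp_mat N B (g i))) < \<epsilon> / 2"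
        if D: "D \<in> ?\<Omega>" and B: "B \<in> ?\<Omega>'" and U: "U \<in> unitary_mats N" and i: "i \<in> F"
          and near: "\<forall>j\<in>F'. op_norm (\<Phi> D j - conj_mat U (B j)) < \<epsilon>'" for D B U i
      proof -
        have gF': "vars (g i) \<subseteq> F'" and gK: "vars (g i) \<subseteq> K" and gV: "vars (g i) \<subseteq> V"
          using i g(1) K\<^sub>0 by (auto simp: F'_def V_def)
        have Bcar: "B j \<in> carrier_mat N N" and Bn: "op_norm (B j) \<le> R" if "j \<in> K" for j
          using B that by (auto simp: microstates_def)
        have iL: "i \<in> L" using i F(2) by blast
        let ?X = "eval_exp_mat N (\<Phi> D) (g i)"
        have Xcar: "?X \<in> carrier_mat N N"
          by (rule eval_exp_mat_carrier) (use \<Phi>car[OF D] gK in auto)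
        have Gcar: "eval_exp_mat N B (g i) \<in> carrier_mat N N"
          by (rule eval_exp_mat_carrier) (use Bcar gK in auto)
        have "op_norm (D i - ?X) = op_norm (?X - D i)"
          by (rule op_norm_minus_commute[OF car[OF D iL] Xcar])
        also have "?X - D i = eval_exp_mat N D (r i)"
          by (rule eq_matI) (use Xcar car[OF D iL] in \<open>simp_all add: r_def flip: \<Phi>_eval[OF gK]\<close>)
        also have "op_norm \<dots> \<le> norm (eval_exp y (r i)) + \<delta>'"
          by (rule micro[OF D]) (use i in \<open>simp add: T_def\<close>)
        also have "eval_exp y (r i) = eval_exp y (subst_exp s (g i)) - y i"
          using scaleR_scaleC[of "-1" "y i"] by (simp add: r_def)
        also have "norm \<dots> \<le> norm (eval_exp y (subst_exp s (g i)) - eval_exp x (g i))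
            + norm (eval_exp x (g i) - y i)"
          using norm_triangle_ineq[of "eval_exp y (subst_exp s (g i)) - eval_exp x (g i)" "eval_exp x (g i) - y i"]
          by simp
        also have "\<dots> < \<epsilon> / 8 + \<epsilon> / 8"
        proof (rule add_le_less_mono)
          show "norm (eval_exp y (subst_exp s (g i)) - eval_exp x (g i)) \<le> \<epsilon> / 8"
            using approx[OF gV] mult_left_mono[OF \<eta>(2) lip_nn[of "g i"]] lip_g[OF i] by linarith
        qed (rule g(2)[OF i])
        finally have 1: "op_norm (D i - ?X) < \<epsilon> / 4 + \<epsilon> / 8" using \<delta>'(2) by simp
        have "op_norm (?X - eval_exp_mat N (\<lambda>j. conj_mat U (B j)) (g i)) \<le> exp_lip R (g i) * \<epsilon>'"
        proof (rule eval_exp_mat_lipschitz)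
          fix j assume j: "j \<in> vars (g i)"
          then have jK: "j \<in> K" and jF: "j \<in> F'" using gK gF' by auto
          show "\<Phi> D j \<in> carrier_mat N N" using \<Phi>car[OF D jK] .
          show "conj_mat U (B j) \<in> carrier_mat N N" using U Bcar[OF jK] by simp
          show "op_norm (\<Phi> D j) \<le> R" using map[OF D] jK by (simp add: microstates_def)
          show "op_norm (conj_mat U (B j)) \<le> R"
            using op_norm_conj_le[OF U Bcar[OF jK]] Bn[OF jK] by simp
          show "op_norm (\<Phi> D j - conj_mat U (B j)) \<le> \<epsilon>'" using near jF by (simp add: less_imp_le)
        qed (use R in simp)
        also have "eval_exp_mat N (\<lambda>j. conj_mat U (B j)) (g i) = conj_mat U (eval_exp_mat N B (g i))"
          by (rule eval_exp_mat_conj[OF U]) (use Bcar gK in auto)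
        finally have 2: "op_norm (?X - conj_mat U (eval_exp_mat N B (g i))) \<le> \<epsilon> / 8"
          using lip_g[OF i] by simp
        show ?thesis
          using 1 2 op_norm_minus_triangle[OF car[OF D iL] Xcar conj_mat_carrier[OF U Gcar]] by simp
      qed
      show "orb_covering_number N F \<epsilon> ?\<Omega> \<le> orb_covering_number N F' \<epsilon>' ?\<Omega>'"
      proof (rule orb_covering_number_le_of_map[where \<Phi> = \<Phi>])
        fix D E B U V
        assume D: "D \<in> ?\<Omega>" and E: "E \<in> ?\<Omega>" and B: "B \<in> ?\<Omega>'"
          and U: "U \<in> unitary_mats N" and V: "V \<in> unitary_mats N"
          and nD: "\<forall>j\<in>F'. op_norm (\<Phi> D j - conj_mat U (B j)) < \<epsilon>'"
          and nE: "\<forall>j\<in>F'. op_norm (\<Phi> E j - conj_mat V (B j)) < \<epsilon>'"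
        show "\<exists>W\<in>unitary_mats N. \<forall>i\<in>F. op_norm (D i - conj_mat W (E i)) < \<epsilon>"
        proof (intro bexI ballI)
          show "U * mat_adjoint V \<in> unitary_mats N"
            using U adjoint_unitary[OF V] by (rule mult_unitary_mats)
          fix i assume i: "i \<in> F"
          have "eval_exp_mat N B (g i) \<in> carrier_mat N N"
            using B g(1)[OF i] K\<^sub>0 by (intro eval_exp_mat_carrier) (auto simp: microstates_def)
          moreover have "D i \<in> carrier_mat N N" "E i \<in> carrier_mat N N"
            using car[OF D] car[OF E] i F(2) by blast+
          ultimately have "op_norm (D i - conj_mat (U * mat_adjoint V) (E i))
              \<le> op_norm (D i - conj_mat U (eval_exp_mat N B (g i)))
                + op_norm (E i - conj_mat V (eval_exp_mat N B (g i)))"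
            by (intro op_norm_minus_conj_le[OF U V])
          then show "op_norm (D i - conj_mat (U * mat_adjoint V) (E i)) < \<epsilon>"
            using close[OF D B U i nD] close[OF E B V i nE] by linarith
        qed
      qed (rule map)
    qed
  qed
qed

section \<open>Independence of the generators\<close>

lemma log_enat_mono: "m \<le> n \<Longrightarrow> log_enat m \<le> log_enat n"
  by (cases m; cases n) auto

text \<open>One half of the invariance. The two generation hypotheses are asymmetric: \<open>c\<close> must be approximable by
\<open>a\<close> alone, while \<open>a\<close> and \<open>b\<close> may be approximated by \<open>c\<close> and \<open>d\<close> together.\<close>

lemma h_top_le:
  fixes a :: "'i1 \<Rightarrow> 'x::cstar_algebra" and b :: "'j1 \<Rightarrow> 'x"
    and c :: "'i2 \<Rightarrow> 'x" and d :: "'j2 \<Rightarrow> 'x"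
  assumes R: "0 < R" and bd: "tuple_bounded R I\<^sub>1 a" "tuple_bounded R J\<^sub>1 b"
    and c: "c ` I\<^sub>2 \<subseteq> cstar_generated (a ` I\<^sub>1)"
    and ab: "a ` I\<^sub>1 \<union> b ` J\<^sub>1 \<subseteq> cstar_generated (c ` I\<^sub>2 \<union> d ` J\<^sub>2)"
  shows "h_top S I\<^sub>2 c J\<^sub>2 d \<le> h_top R I\<^sub>1 a J\<^sub>1 b"
  unfolding h_top_def[of S]
proof (rule SUP_least, clarify)
  fix \<epsilon> :: real and F assume \<epsilon>: "0 < \<epsilon>" and F: "finite F" "F \<subseteq> I\<^sub>2"
  let ?K = "I\<^sub>1 <+> J\<^sub>1" and ?L = "I\<^sub>2 <+> J\<^sub>2" and ?x = "case_sum a b" and ?y = "case_sum c d"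
  have im: "?x ` ?K = a ` I\<^sub>1 \<union> b ` J\<^sub>1" "?y ` ?L = c ` I\<^sub>2 \<union> d ` J\<^sub>2" "?x ` Inl ` I\<^sub>1 = a ` I\<^sub>1"
    "?y ` Inl ` F = c ` F"
    by (auto simp: Plus_def image_Un image_image)
  have bound: "norm (?x j) \<le> R" if "j \<in> ?K" for j
    using that bd by (auto simp: tuple_bounded_def)
  have gen: "?x ` ?K \<subseteq> cstar_generated (?y ` ?L)"
    unfolding im by (rule ab)
  have gen': "?y ` Inl ` F \<subseteq> cstar_generated (?x ` Inl ` I\<^sub>1)"
    unfolding im using c F by blast
  have Inl_sub: "Inl ` I\<^sub>1 \<subseteq> ?K" by auto
  obtain F' \<epsilon>' where F': "finite F'" "F' \<subseteq> Inl ` I\<^sub>1" "0 < \<epsilon>'" and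
    tr: "\<And>\<delta> Q. 0 < \<delta> \<Longrightarrow> finite Q \<Longrightarrow> Q \<subseteq> star_polys ?K \<Longrightarrow>
      \<exists>\<delta>' Q'. 0 < \<delta>' \<and> finite Q' \<and> Q' \<subseteq> star_polys ?L \<and>
        (\<forall>N. orb_covering_number N (Inl ` F) \<epsilon> (microstates S N ?L ?y Q' \<delta>')
          \<le> orb_covering_number N F' \<epsilon>' (microstates R N ?K ?x Q \<delta>))"
    by (rule orb_covering_number_microstates_transfer
        [OF R bound gen _ _ Inl_sub gen' \<epsilon>, where S = S]) (use F in auto)
  obtain F\<^sub>1 where F\<^sub>1: "finite F\<^sub>1" "F\<^sub>1 \<subseteq> I\<^sub>1" "F' = Inl ` F\<^sub>1"
    using F'(1,2) by (meson finite_subset_image)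
  let ?h = "\<lambda>S I a J b \<epsilon> F \<delta> Q. limsup (\<lambda>N. ereal (1 / (real N)\<^sup>2) *
    log_enat (orb_covering_number N (Inl ` F) \<epsilon> (microstates S N (I <+> J) (case_sum a b) Q \<delta>)))"
  have "(INF (\<delta>, Q)\<in>{0<..} \<times> {Q. finite Q \<and> Q \<subseteq> star_polys ?L}. ?h S I\<^sub>2 c J\<^sub>2 d \<epsilon> F \<delta> Q)
      \<le> (INF (\<delta>, Q)\<in>{0<..} \<times> {Q. finite Q \<and> Q \<subseteq> star_polys ?K}. ?h R I\<^sub>1 a J\<^sub>1 b \<epsilon>' F\<^sub>1 \<delta> Q)"
  proof (rule INF_greatest, clarify)
    fix \<delta> :: real and Q :: "('i1 + 'j1) star_poly set"
    assume "0 < \<delta>" "finite Q" "Q \<subseteq> star_polys ?K"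
    from tr[OF this] obtain \<delta>' Q' where *: "0 < \<delta>'" "finite Q'" "Q' \<subseteq> star_polys ?L"
      "\<And>N. orb_covering_number N (Inl ` F) \<epsilon> (microstates S N ?L ?y Q' \<delta>')
          \<le> orb_covering_number N (Inl ` F\<^sub>1) \<epsilon>' (microstates R N ?K ?x Q \<delta>)"
      using F\<^sub>1(3) by blast
    have "?h S I\<^sub>2 c J\<^sub>2 d \<epsilon> F \<delta>' Q' \<le> ?h R I\<^sub>1 a J\<^sub>1 b \<epsilon>' F\<^sub>1 \<delta> Q"
      by (intro Limsup_mono always_eventually allI ereal_mult_left_mono log_enat_mono *(4)) simp
    then show "(INF (\<delta>, Q)\<in>{0<..} \<times> {Q. finite Q \<and> Q \<subseteq> star_polys ?L}. ?h S I\<^sub>2 c J\<^sub>2 d \<epsilon> F \<delta> Q)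
        \<le> ?h R I\<^sub>1 a J\<^sub>1 b \<epsilon>' F\<^sub>1 \<delta> Q"
      by (intro INF_lower2[of "(\<delta>', Q')"]) (use * in auto)
  qed
  also have "\<dots> \<le> h_top R I\<^sub>1 a J\<^sub>1 b"
    unfolding h_top_def by (rule SUP_upper2[of "(\<epsilon>', F\<^sub>1)"]) (use F' F\<^sub>1 in auto)
  finally show "(INF (\<delta>, Q)\<in>{0<..} \<times> {Q. finite Q \<and> Q \<subseteq> star_polys ?L}. ?h S I\<^sub>2 c J\<^sub>2 d \<epsilon> F \<delta> Q)
      \<le> h_top R I\<^sub>1 a J\<^sub>1 b" .
qed

lemma subset_cstar_generated: "X \<subseteq> cstar_generated X"
  unfolding cstar_generated_def by (meson closure_subset hull_subset order_trans)

theorem theorem7p1: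
  fixes \<A> :: "'x::cstar_algebra set"
    and R S :: real
    and I\<^sub>1 :: "'i1 set" and J\<^sub>1 :: "'j1 set" and I\<^sub>2 :: "'i2 set" and J\<^sub>2 :: "'j2 set"
    and a :: "'i1 \<Rightarrow> 'x" and b :: "'j1 \<Rightarrow> 'x"
    and c :: "'i2 \<Rightarrow> 'x" and d :: "'j2 \<Rightarrow> 'x"
  assumes "unital_cstar_subalgebra \<A>"
    and "R > 0" and "S > 0"
    and "tuple_bounded R I\<^sub>1 a" and "tuple_bounded R J\<^sub>1 b"
    and "cstar_generated (a ` I\<^sub>1) = \<A>"
    and "cstar_generated (a ` I\<^sub>1 \<union> b ` J\<^sub>1) = UNIV"
    and "tuple_bounded S I\<^sub>2 c" and "tuple_bounded S J\<^sub>2 d"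
    and "cstar_generated (c ` I\<^sub>2) = \<A>"
    and "cstar_generated (c ` I\<^sub>2 \<union> d ` J\<^sub>2) = UNIV"
  shows "h_top R I\<^sub>1 a J\<^sub>1 b = h_top S I\<^sub>2 c J\<^sub>2 d"
proof (rule antisym)
  have "a ` I\<^sub>1 \<subseteq> cstar_generated (c ` I\<^sub>2)" "c ` I\<^sub>2 \<subseteq> cstar_generated (a ` I\<^sub>1)"
    using assms(6,10) subset_cstar_generated by metis+
  then show "h_top R I\<^sub>1 a J\<^sub>1 b \<le> h_top S I\<^sub>2 c J\<^sub>2 d" "h_top S I\<^sub>2 c J\<^sub>2 d \<le> h_top R I\<^sub>1 a J\<^sub>1 b"
    using assms by (auto intro!: h_top_le)
qed

end
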